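(* Let $u_0\in\mathcal S(\mathbb R)$, let $u_S$ be the solution of the free Schrödinger equation on the line $i\,\partial_tu_S(t)=-\frac12\,\partial_{xx}u_S(t)$, $t\in\mathbb R$, $u_S(0)=u_0$, and define $t^*\in\mathbb R$ by $$t^*:=\operatorname*{arg\,min}_{\tau\in\mathbb R}\left(\int_{\mathbb R}x^2|u_S(\tau,x)|^2\,dx-\Big(\int_{\mathbb R}x\,|u_S(\tau,x)|^2\,dx\Big)^2\right).$$ Then for all $p\in[2,\infty]$, we have $$\forall\,t\in\mathbb R\setminus\{t^*\}\qquad\|u_S(t,\cdot)\|_{L^p(\mathbb R)}\leqslant\left(\frac1{4\pi}\right)^{-\frac12+\frac1p}\|u_S(t^*,\cdot)\|_{L^{p'}(\mathbb R)}\,|t-t^*|^{-\frac12+\frac1p},$$ where $p'$ is the conjugate exponent of $p$.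
   Context: $\mathcal S(\mathbb R)$ is the Schwartz space. The solution is $u_S(t,x)=\frac1{2\pi}\int_{\mathbb R}\mathcal F u_0(p)\,e^{-\frac12itp^2+ixp}\,dp$ with $\mathcal F u(p)=\int_{\mathbb R}u(x)e^{-ixp}\,dx$. The conjugate exponent satisfies $\frac1p+\frac1{p'}=1$, with $\frac1\infty=0$. *)

theory Defs
  imports "HOL-Probability.Essential_Supremum"
begin

text \<open>The sequence \<open>D\<close> consists of the successive derivatives of \<open>f\<close>; it is uniquely
  determined by \<open>f\<close>, and its existence says that \<open>f\<close> is smooth.\<close>

definition schwartz :: "(real \<Rightarrow> complex) \<Rightarrow> bool" where
  "schwartz f \<longleftrightarrow>
     (\<exists>D :: nat \<Rightarrow> real \<Rightarrow> complex.
        D 0 = f \<and>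
        (\<forall>n x. (D n has_vector_derivative D (Suc n) x) (at x)) \<and>
        (\<forall>k n. bounded (range (\<lambda>x. x ^ k *\<^sub>R D n x))))"

definition fourier :: "(real \<Rightarrow> complex) \<Rightarrow> real \<Rightarrow> complex" where
  "fourier u p = (CLBINT x. u x * exp (- \<i> * of_real x * of_real p))"

text \<open>The solution of \<open>\<i> \<partial>\<^sub>t u = - 1/2 \<partial>\<^sub>x\<^sub>x u\<close> with initial datum \<open>u0\<close>,
  given by its Fourier representation.\<close>

definition schrodinger_sol :: "(real \<Rightarrow> complex) \<Rightarrow> real \<Rightarrow> real \<Rightarrow> complex" where
  "schrodinger_sol u0 t x =
     1 / (2 * of_real pi) *
     (CLBINT p. fourier u0 p *
        exp (- (1 / 2) * \<i> * of_real t * (of_real p)\<^sup>2 + \<i> * of_real x * of_real p))"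

definition position_variance :: "(real \<Rightarrow> complex) \<Rightarrow> real" where
  "position_variance v =
     (LBINT x. x\<^sup>2 * (cmod (v x))\<^sup>2) - (LBINT x. x * (cmod (v x))\<^sup>2)\<^sup>2"

definition ennreal_powr :: "ennreal \<Rightarrow> real \<Rightarrow> ennreal" where
  "ennreal_powr y a = (if y = \<infinity> then \<infinity> else ennreal (enn2real y powr a))"

text \<open>The norm of \<open>L\<^sup>p(\<real>)\<close> for \<open>1 \<le> p \<le> \<infinity>\<close>, with value \<open>\<infinity>\<close> for functions outside
  \<open>L\<^sup>p(\<real>)\<close>.\<close>

definition Lp_norm :: "ennreal \<Rightarrow> (real \<Rightarrow> complex) \<Rightarrow> ennreal" where
  "Lp_norm p f =
     (if p = \<infinity> then esssup lborel (\<lambda>x. ennreal (cmod (f x)))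
      else ennreal_powr (\<integral>\<^sup>+x. ennreal (cmod (f x) powr enn2real p) \<partial>lborel) (1 / enn2real p))"

end

theory Submission
  imports Defs "HOL-Probability.Characteristic_Functions" "HOL-Probability.Sinc_Integral"
    "HOL-Complex_Analysis.Conformal_Mappings"
begin

text \<open>
  Two facts about the free evolution carry the estimate. First, for \<open>t \<noteq> t0\<close> the solution at time
  \<open>t\<close> is, up to a factor of modulus 1, a rescaled Fourier transform of \<open>g\<close>, where \<open>g\<close> is the reflected
  solution at time \<open>t0\<close> times a quadratic phase: with \<open>s = t - t0\<close>,
  \<open>|u\<^sub>S(t,x)| = (2 \<pi> |s|)\<^bsup>-1/2\<^esup> |\<F> g(-x/s)|\<close> and \<open>|g(y)| = |u\<^sub>S(t0,-y)|\<close>.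
  This is \<open>schrodinger_sol_between_times\<close>. Second, the Hausdorff--Young inequality
  \<open>\<parallel>\<F> g\<parallel>\<^sub>p \<le> (2 \<pi>)\<^bsup>1/p\<^esup> \<parallel>g\<parallel>\<^sub>p\<^sub>'\<close> (\<open>hausdorff_young\<close>). Since \<open>g\<close> has the same \<open>L\<^sup>q\<close> norms as \<open>u\<^sub>S(t0)\<close>,
  rescaling gives the decay \<open>(2 \<pi> |t - t0|)\<^bsup>-1/2 + 1/p\<^esup>\<close> for \<open>2 \<le> p < \<infinity>\<close> (\<open>dispersive_estimate\<close>);
  for \<open>p = \<infinity>\<close> the bound \<open>|\<F> g| \<le> \<parallel>g\<parallel>\<^sub>1\<close> takes the place of Hausdorff--Young. The constant of the theorem
  follows because the exponent is nonpositive and \<open>1 / (4 \<pi>) \<le> 2 \<pi>\<close>.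

  For the first fact, let \<open>w\<close> be \<open>\<F> u0\<close> times the phase of time \<open>t0\<close>. Then \<open>u\<^sub>S(t0,x)\<close> is
  \<open>\<F> w (-x) / (2 \<pi>)\<close>, while \<open>u\<^sub>S(t)\<close> integrates \<open>w\<close> against a complex Gaussian of purely imaginary
  variance. Parseval's formula moves that Gaussian onto \<open>\<F> w\<close> (\<open>fourier_parseval_chirp\<close>); it is
  obtained from Fubini for Gaussians of positive real part and a passage to the limit. This needs \<open>w\<close> and
  \<open>\<F> w\<close> to be integrable, which holds because the Schwartz space is stable under the Fourier transform and
  under multiplication by quadratic phases.

  The Hausdorff--Young inequality interpolates between \<open>|\<F> g| \<le> \<parallel>g\<parallel>\<^sub>1\<close> and the Plancherel inequality
  (\<open>fourier_L2_le\<close>), by complex interpolation. One bounds the pairing of a function \<open>h\<close> with \<open>\<F> g\<close>: \<open>g\<close>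
  and \<open>h\<close> are embedded in families \<open>g\<^sub>z\<close>, \<open>h\<^sub>z\<close> whose pairing is holomorphic in \<open>z\<close>, and the three lines
  theorem is applied. Truncating \<open>g\<close> and \<open>h\<close> so that their moduli stay between \<open>1/N\<close> and \<open>N\<close> on a
  bounded support makes every integral in sight converge. The truncation of \<open>g\<close> is removed by dominated
  convergence and that of \<open>h\<close>, which is chosen by duality, by Fatou's lemma.
\<close>

section \<open>Integrals depending on a parameter\<close>

lemma integrable_times_unimodular:
  fixes f :: "'a \<Rightarrow> complex"
  assumes "integrable M f" "e \<in> borel_measurable M" "\<And>x. norm (e x) \<le> 1"
  shows "integrable M (\<lambda>x. f x * e x)"
  using assms
  by (intro Bochner_Integration.integrable_bound[OF assms(1)])
    (auto simp: norm_mult intro!: mult_left_le)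

lemma integrable_tensor:
  fixes f :: "'a \<Rightarrow> complex" and g :: "'b \<Rightarrow> complex"
  assumes "sigma_finite_measure M" "sigma_finite_measure N" "integrable M f" "integrable N g"
  shows "integrable (M \<Otimes>\<^sub>M N) (\<lambda>z. f (fst z) * g (snd z))"
proof -
  interpret pair_sigma_finite M N using assms by (simp add: pair_sigma_finite_def)
  note [measurable] = borel_measurable_integrable[OF assms(3)] borel_measurable_integrable[OF assms(4)]
  show ?thesis
    by (rule Fubini_integrable) (use assms in \<open>auto simp: norm_mult\<close>)
qed

lemma nn_integral_limit_le:
  fixes u :: "nat \<Rightarrow> 'a \<Rightarrow> ennreal"
  assumes [measurable]: "\<And>n. u n \<in> borel_measurable M"
    and lim: "\<And>x. (\<lambda>n. u n x) \<longlonglongrightarrow> v x"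
    and le: "\<And>n. (\<integral>\<^sup>+x. u n x \<partial>M) \<le> C"
  shows "(\<integral>\<^sup>+x. v x \<partial>M) \<le> C"
proof -
  have "(\<integral>\<^sup>+x. v x \<partial>M) = (\<integral>\<^sup>+x. liminf (\<lambda>n. u n x) \<partial>M)"
    using lim by (intro nn_integral_cong) (rule lim_imp_Liminf[OF trivial_limit_sequentially, symmetric])
  also have "\<dots> \<le> liminf (\<lambda>n. \<integral>\<^sup>+x. u n x \<partial>M)"
    by (rule nn_integral_liminf) simp
  also have "\<dots> \<le> liminf (\<lambda>n::nat. C)"
    by (rule Liminf_mono) (use le in simp)
  also have "\<dots> = C" by (simp add: Liminf_const)
  finally show ?thesis .
qed

text \<open>
  The derivative is taken within a convex set of complex parameters. An open set gives holomorphy;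
  the real line gives derivatives in a real parameter, where the integrand may not be integrable for
  any nonreal parameter. Convexity turns the bound on the derivative into a bound on difference
  quotients, so dominated convergence applies.
\<close>

lemma has_field_derivative_integral:
  fixes g :: "'a \<Rightarrow> complex \<Rightarrow> complex"
  assumes "convex S" "z \<in> S"
    and int: "\<And>w. w \<in> S \<Longrightarrow> integrable M (\<lambda>x. g x w)"
    and der: "\<And>x w. w \<in> S \<Longrightarrow> (g x has_field_derivative g' x w) (at w within S)"
    and bound: "\<And>x w. w \<in> S \<Longrightarrow> norm (g' x w) \<le> h x"
    and h: "integrable M h"
    and meas: "(\<lambda>x. g' x z) \<in> borel_measurable M"
  shows "((\<lambda>w. \<integral>x. g x w \<partial>M) has_field_derivative (\<integral>x. g' x z \<partial>M)) (at z within S)"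
  unfolding has_field_derivative_iff tendsto_at_iff_sequentially
proof (intro allI impI)
  fix X :: "nat \<Rightarrow> complex"
  assume XS: "\<forall>i. X i \<in> S - {z}" and Xz: "X \<longlonglongrightarrow> z"
  note [measurable] = meas borel_measurable_integrable[OF int]
  have "(\<lambda>i. \<integral>x. (g x (X i) - g x z) / (X i - z) \<partial>M) \<longlonglongrightarrow> (\<integral>x. g' x z \<partial>M)"
  proof (rule integral_dominated_convergence[where w = h])
    show "(\<lambda>x. (g x (X i) - g x z) / (X i - z)) \<in> borel_measurable M" for i
      using XS int \<open>z \<in> S\<close> by (intro borel_measurable_divide borel_measurable_diff) auto
    show "AE x in M. (\<lambda>i. (g x (X i) - g x z) / (X i - z)) \<longlonglongrightarrow> g' x z"
    proof (rule AE_I2)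
      fix x
      from der[OF \<open>z \<in> S\<close>, of x] show "(\<lambda>i. (g x (X i) - g x z) / (X i - z)) \<longlonglongrightarrow> g' x z"
        unfolding has_field_derivative_iff tendsto_at_iff_sequentially comp_def
        using XS Xz by blast
    qed
    show "AE x in M. norm ((g x (X i) - g x z) / (X i - z)) \<le> h x" for i
    proof (rule AE_I2)
      fix x
      have "norm (g x (X i) - g x z) \<le> h x * norm (X i - z)"
        using XS \<open>z \<in> S\<close> by (intro field_differentiable_bound[OF \<open>convex S\<close> der bound]) auto
      moreover have "X i \<noteq> z" using XS by auto
      ultimately show "norm ((g x (X i) - g x z) / (X i - z)) \<le> h x"
        by (simp add: norm_divide field_simps)
    qed
  qed (use h meas in auto)
  moreover have "(\<integral>x. (g x (X i) - g x z) / (X i - z) \<partial>M)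
      = ((\<integral>x. g x (X i) \<partial>M) - (\<integral>x. g x z \<partial>M)) / (X i - z)" for i
    using XS int \<open>z \<in> S\<close> by simp
  ultimately show "((\<lambda>w. ((\<integral>x. g x w \<partial>M) - (\<integral>x. g x z \<partial>M)) / (w - z)) \<circ> X)
      \<longlonglongrightarrow> (\<integral>x. g' x z \<partial>M)"
    by (simp only: comp_def)
qed

section \<open>Schwartz functions\<close>

text \<open>
  Iterating the derivative within the class \<open>X\<close> produces the sequence of successive derivatives of \<open>f\<close>.
  Each closure property below thus reduces to a single differentiation in a well-chosen class.
\<close>

lemma schwartz_coinduct:
  assumes "f \<in> X"
    and step: "\<And>f. f \<in> X \<Longrightarrow> \<exists>g\<in>X. \<forall>x. (f has_vector_derivative g x) (at x)"
    and bdd: "\<And>f k. f \<in> X \<Longrightarrow> bounded (range (\<lambda>x. x ^ k *\<^sub>R f x))"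
  shows "schwartz f"
proof -
  obtain d where d: "\<And>f. f \<in> X \<Longrightarrow> d f \<in> X \<and> (\<forall>x. (f has_vector_derivative d f x) (at x))"
    using step by metis
  define D where "D = (\<lambda>n. (d ^^ n) f)"
  have DX: "D n \<in> X" for n
    by (induction n) (use \<open>f \<in> X\<close> d in \<open>auto simp: D_def\<close>)
  have "(D n has_vector_derivative D (Suc n) x) (at x)" for n x
    using d[OF DX[of n]] by (simp add: D_def)
  then show ?thesis
    unfolding schwartz_def using bdd[OF DX] by (intro exI[of _ D]) (auto simp: D_def)
qed

lemma schwartz_derivative:
  assumes "schwartz f"
  obtains g where "schwartz g" "\<And>x. (f has_vector_derivative g x) (at x)"
proof -
  obtain D where D: "D 0 = f" "\<And>n x. (D n has_vector_derivative D (Suc n) x) (at x)"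
    "\<And>k n. bounded (range (\<lambda>x. x ^ k *\<^sub>R D n x))"
    using assms unfolding schwartz_def by blast
  have "schwartz (D 1)"
    unfolding schwartz_def by (rule exI[of _ "\<lambda>n. D (Suc n)"]) (use D in auto)
  then show ?thesis using D that by (metis One_nat_def)
qed

lemma schwartz_decay:
  assumes "schwartz f"
  shows "bounded (range (\<lambda>x. x ^ k *\<^sub>R f x))"
  using assms unfolding schwartz_def by metis

lemma schwartz_continuous:
  assumes "schwartz f"
  shows "isCont f x"
  by (metis assms schwartz_derivative has_vector_derivative_continuous)

lemma schwartz_measurable:
  assumes "schwartz f"
  shows "f \<in> borel_measurable borel"
  using schwartz_continuous[OF assms]
  by (intro borel_measurable_continuous_onI) (simp add: continuous_at_imp_continuous_on)

lemma schwartz_add: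
  assumes "schwartz f" "schwartz g"
  shows "schwartz (\<lambda>x. f x + g x)"
proof (rule schwartz_coinduct[where X = "{\<lambda>x. f x + g x |f g. schwartz f \<and> schwartz g}"])
  fix k :: nat and q assume "q \<in> {\<lambda>x. f x + g x |f g. schwartz f \<and> schwartz g}"
  then obtain f g where [simp]: "q = (\<lambda>x. f x + g x)" and "schwartz f" "schwartz g"
    by auto
  obtain f' where f': "schwartz f'" "\<And>x. (f has_vector_derivative f' x) (at x)"
    using schwartz_derivative[OF \<open>schwartz f\<close>] by metis
  obtain g' where g': "schwartz g'" "\<And>x. (g has_vector_derivative g' x) (at x)"
    using schwartz_derivative[OF \<open>schwartz g\<close>] by metis
  show "\<exists>h\<in>{\<lambda>x. f x + g x |f g. schwartz f \<and> schwartz g}. \<forall>x. (q has_vector_derivative h x) (at x)"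
    by (rule bexI[of _ "\<lambda>x. f' x + g' x"])
      (use f' g' in \<open>auto intro!: derivative_eq_intros\<close>)
  show "bounded (range (\<lambda>x. x ^ k *\<^sub>R q x))"
    using bounded_plus_comp[OF schwartz_decay[OF \<open>schwartz f\<close>] schwartz_decay[OF \<open>schwartz g\<close>]]
    by (simp add: scaleR_right_distrib)
qed (use assms in auto)

lemma schwartz_cmult:
  assumes "schwartz f"
  shows "schwartz (\<lambda>x. c * f x)"
proof (rule schwartz_coinduct[where X = "{\<lambda>x. c * f x |f. schwartz f}"])
  fix k :: nat and q assume "q \<in> {\<lambda>x. c * f x |f. schwartz f}"
  then obtain f where [simp]: "q = (\<lambda>x. c * f x)" and "schwartz f" by auto
  obtain f' where f': "schwartz f'" "\<And>x. (f has_vector_derivative f' x) (at x)"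
    using schwartz_derivative[OF \<open>schwartz f\<close>] by metis
  show "\<exists>h\<in>{\<lambda>x. c * f x |f. schwartz f}. \<forall>x. (q has_vector_derivative h x) (at x)"
    by (rule bexI[of _ "\<lambda>x. c * f' x"]) (use f' in \<open>auto intro!: derivative_eq_intros\<close>)
  show "bounded (range (\<lambda>x. x ^ k *\<^sub>R q x))"
    using bounded_linear_image[OF schwartz_decay[OF \<open>schwartz f\<close>] bounded_linear_mult_right[of c]]
    by (simp add: image_image)
qed (use assms in auto)

lemma schwartz_times_of_real:
  assumes "schwartz f"
  shows "schwartz (\<lambda>x. of_real x * f x)"
proof (rule schwartz_coinduct[where X = "{\<lambda>x. of_real x * f x + g x |f g. schwartz f \<and> schwartz g}"])
  \<comment> \<open>The products \<open>x f\<close> alone are not stable under differentiation; the sums \<open>x f + g\<close> are.\<close>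
  fix k :: nat and q assume "q \<in> {\<lambda>x. of_real x * f x + g x |f g. schwartz f \<and> schwartz g}"
  then obtain f g where [simp]: "q = (\<lambda>x. of_real x * f x + g x)" and "schwartz f" "schwartz g"
    by auto
  obtain f' where f': "schwartz f'" "\<And>x. (f has_vector_derivative f' x) (at x)"
    using schwartz_derivative[OF \<open>schwartz f\<close>] by metis
  obtain g' where g': "schwartz g'" "\<And>x. (g has_vector_derivative g' x) (at x)"
    using schwartz_derivative[OF \<open>schwartz g\<close>] by metis
  have "schwartz (\<lambda>x. f x + g' x)" using \<open>schwartz f\<close> g' by (intro schwartz_add)
  moreover have "(q has_vector_derivative of_real x * f' x + (f x + g' x)) (at x)" for x
    using f' g' by (auto intro!: derivative_eq_intros)
  ultimately show "\<exists>h\<in>{\<lambda>x. of_real x * f x + g x |f g. schwartz f \<and> schwartz g}.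
      \<forall>x. (q has_vector_derivative h x) (at x)"
    using f' by (intro bexI[of _ "\<lambda>x. of_real x * f' x + (f x + g' x)"]) auto
  show "bounded (range (\<lambda>x. x ^ k *\<^sub>R q x))"
    using bounded_plus_comp[OF schwartz_decay[OF \<open>schwartz f\<close>, of "Suc k"] schwartz_decay[OF \<open>schwartz g\<close>, of k]]
    by (simp add: scaleR_conv_of_real algebra_simps)
next
  have "schwartz (\<lambda>x. 0 * f x)" using assms by (rule schwartz_cmult)
  then show "(\<lambda>x. of_real x * f x) \<in> {\<lambda>x. of_real x * f x + g x |f g. schwartz f \<and> schwartz g}"
    using assms by force
qed

lemma schwartz_times_chirp:
  fixes c :: real
  assumes "schwartz f"
  shows "schwartz (\<lambda>x. f x * exp (\<i> * of_real (c * x\<^sup>2)))"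
proof (rule schwartz_coinduct[where X = "{\<lambda>x. f x * exp (\<i> * of_real (c * x\<^sup>2)) |f. schwartz f}"])
  fix k :: nat and q assume "q \<in> {\<lambda>x. f x * exp (\<i> * of_real (c * x\<^sup>2)) |f. schwartz f}"
  then obtain f where [simp]: "q = (\<lambda>x. f x * exp (\<i> * of_real (c * x\<^sup>2)))" and "schwartz f" by auto
  obtain f' where f': "schwartz f'" "\<And>x. (f has_vector_derivative f' x) (at x)"
    using schwartz_derivative[OF \<open>schwartz f\<close>] by metis
  have "schwartz (\<lambda>x. f' x + 2 * \<i> * of_real c * (of_real x * f x))"
    using f' \<open>schwartz f\<close> by (intro schwartz_add schwartz_cmult schwartz_times_of_real)
  moreover have "(q has_vector_derivative
      (f' x + 2 * \<i> * of_real c * (of_real x * f x)) * exp (\<i> * of_real (c * x\<^sup>2))) (at x)" for x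
  proof -
    have "((\<lambda>x. exp (\<i> * of_real (c * x\<^sup>2))) has_vector_derivative
        (2 * \<i> * of_real c * of_real x) * exp (\<i> * of_real (c * x\<^sup>2))) (at x)"
    proof -
      have "((\<lambda>z. exp (\<i> * (of_real c * z\<^sup>2))) has_field_derivative
          (2 * \<i> * of_real c * of_real x) * exp (\<i> * of_real (c * x\<^sup>2))) (at (of_real x))"
        by (auto intro!: derivative_eq_intros)
      from has_vector_derivative_real_field[OF this] show ?thesis by simp
    qed
    from has_vector_derivative_mult[OF f'(2) this] show ?thesis
      by (simp add: algebra_simps)
  qed
  ultimately show "\<exists>h\<in>{\<lambda>x. f x * exp (\<i> * of_real (c * x\<^sup>2)) |f. schwartz f}.
      \<forall>x. (q has_vector_derivative h x) (at x)"
    by (intro bexI[of _ "\<lambda>x. (f' x + 2 * \<i> * of_real c * (of_real x * f x)) * exp (\<i> * of_real (c * x\<^sup>2))"]) auto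
  show "bounded (range (\<lambda>x. x ^ k *\<^sub>R q x))"
    using schwartz_decay[OF \<open>schwartz f\<close>, of k]
    by (simp add: bounded_iff norm_mult)
qed (use assms in auto)

lemma integrable_schwartz:
  assumes "schwartz f"
  shows "integrable lborel f"
proof -
  obtain B0 where B0: "norm (f x) \<le> B0" for x
    using schwartz_decay[OF assms, of 0] by (auto simp: bounded_iff)
  obtain B2 where B2: "norm (x\<^sup>2 *\<^sub>R f x) \<le> B2" for x
    using schwartz_decay[OF assms, of 2] by (auto simp: bounded_iff)
  show ?thesis
  proof (rule Bochner_Integration.integrable_bound)
    show "integrable lborel (\<lambda>x::real. (B0 + B2) * inverse (1 + x\<^sup>2))"
      using integrable_inverse_1_plus_square by (simp add: set_integrable_def)
    show "f \<in> borel_measurable lborel" using schwartz_measurable[OF assms] by simp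
    show "AE x in lborel. norm (f x) \<le> norm ((B0 + B2) * inverse (1 + x\<^sup>2))"
    proof (rule AE_I2)
      fix x :: real
      have pos: "0 < 1 + x\<^sup>2" by (simp add: add_pos_nonneg)
      have "(1 + x\<^sup>2) * norm (f x) \<le> B0 + B2"
        using B0[of x] B2[of x] by (simp add: algebra_simps)
      then have "norm (f x) \<le> (B0 + B2) * inverse (1 + x\<^sup>2)"
        using pos by (simp add: field_simps)
      also have "\<dots> \<le> norm ((B0 + B2) * inverse (1 + x\<^sup>2))" by simp
      finally show "norm (f x) \<le> norm ((B0 + B2) * inverse (1 + x\<^sup>2))" .
    qed
  qed
qed

section \<open>The Fourier transform\<close>

lemma fourier_integrand_integrable:
  assumes "integrable lborel f"
  shows "integrable lborel (\<lambda>x. f x * exp (- \<i> * of_real x * of_real p))"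
  by (rule integrable_times_unimodular[OF assms]) auto

lemma norm_fourier_le:
  assumes "integrable lborel f"
  shows "norm (fourier f p) \<le> (\<integral>x. norm (f x) \<partial>lborel)"
proof -
  have "norm (fourier f p) \<le> (\<integral>x. norm (f x * exp (- \<i> * of_real x * of_real p)) \<partial>lborel)"
    unfolding fourier_def by (rule integral_norm_bound)
  then show ?thesis by (simp add: norm_mult)
qed

lemma fourier_continuous:
  assumes "integrable lborel f"
  shows "isCont (fourier f) p"
  unfolding isCont_def fourier_def tendsto_at_iff_sequentially comp_def
proof (intro allI impI)
  fix X assume X: "X \<longlonglongrightarrow> p"
  note [measurable] = borel_measurable_integrable[OF assms, simplified]
  show "(\<lambda>i. CLBINT x. f x * exp (- \<i> * of_real x * of_real (X i))) \<longlonglongrightarrow>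
      (CLBINT x. f x * exp (- \<i> * of_real x * of_real p))"
  proof (rule integral_dominated_convergence[where w = "\<lambda>x. norm (f x)"])
    show "AE x in lborel. (\<lambda>i. f x * exp (- \<i> * of_real x * of_real (X i)))
        \<longlonglongrightarrow> f x * exp (- \<i> * of_real x * of_real p)"
      by (intro AE_I2 tendsto_intros X)
  qed (use assms in \<open>auto simp: norm_mult\<close>)
qed

lemma fourier_measurable:
  assumes "integrable lborel f"
  shows "fourier f \<in> borel_measurable borel"
  using fourier_continuous[OF assms]
  by (intro borel_measurable_continuous_onI) (simp add: continuous_at_imp_continuous_on)

lemma fourier_derivative:
  assumes f: "schwartz f"
  shows "(fourier f has_vector_derivative fourier (\<lambda>x. - \<i> * (of_real x * f x)) p) (at p)"
proof -
  let ?g = "\<lambda>x w. f x * exp (- \<i> * of_real x * w)"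
  note [measurable] = schwartz_measurable[OF f]
  have xf: "schwartz (\<lambda>x. of_real x * f x)" by (rule schwartz_times_of_real[OF f])
  have "((\<lambda>w. CLBINT x. ?g x w) has_field_derivative
     (CLBINT x. - \<i> * of_real x * f x * exp (- \<i> * of_real x * of_real p))) (at (of_real p) within \<real>)"
  proof (rule has_field_derivative_integral[where h = "\<lambda>x. norm (of_real x * f x)"])
    show "integrable lborel (\<lambda>x. ?g x w)" if "w \<in> \<real>" for w
      using that fourier_integrand_integrable[OF integrable_schwartz[OF f]] by (auto elim!: Reals_cases)
    show "(?g x has_field_derivative - \<i> * of_real x * f x * exp (- \<i> * of_real x * w)) (at w within \<real>)" for x w
      by (auto intro!: derivative_eq_intros)
    show "norm (- \<i> * of_real x * f x * exp (- \<i> * of_real x * w)) \<le> norm (of_real x * f x)"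
      if "w \<in> \<real>" for x w
      using that by (auto simp: norm_mult elim!: Reals_cases)
    show "convex (\<real>::complex set)"
      by (rule convexI) (auto simp: scaleR_conv_of_real)
    show "integrable lborel (\<lambda>x. norm (of_real x * f x))"
      using integrable_schwartz[OF xf] by simp
  qed auto
  then have "((\<lambda>w. CLBINT x. ?g x w) \<circ> of_real has_vector_derivative
     1 * (CLBINT x. - \<i> * of_real x * f x * exp (- \<i> * of_real x * of_real p))) (at p)"
    by (intro field_vector_diff_chain_within has_vector_derivative_of_real)
       (auto simp: Reals_def intro!: derivative_eq_intros)
  then show ?thesis by (simp add: fourier_def[abs_def] comp_def mult.assoc)
qed

lemma tendsto_schwartz_infinity:
  assumes "schwartz f"
  shows "(f \<longlongrightarrow> 0) at_infinity"
proof -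
  obtain B where B: "norm (x *\<^sub>R f x) \<le> B" for x
    using schwartz_decay[OF assms, of 1] by (auto simp: bounded_iff)
  have "((\<lambda>x::real. B / norm x) \<longlongrightarrow> 0) at_infinity"
    by (intro tendsto_divide_0[OF tendsto_const] filterlim_at_top_imp_at_infinity filterlim_norm_at_top)
  moreover have "\<forall>\<^sub>F x in at_infinity. norm (f x) \<le> B / norm x"
    unfolding eventually_at_infinity
    by (rule exI[of _ 1]) (use B in \<open>auto simp: field_simps\<close>)
  ultimately show ?thesis by (rule Lim_null_comparison[rotated])
qed

text \<open>
  Integration by parts: the integral over the line of the derivative of \<open>f x * exp (- \<i> x p)\<close> vanishes,
  since \<open>f\<close> tends to 0 at infinity.
\<close>

lemma fourier_of_derivative:
  assumes f: "schwartz f" and f': "schwartz f'" "\<And>x. (f has_vector_derivative f' x) (at x)"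
  shows "fourier f' p = \<i> * of_real p * fourier f p"
proof -
  let ?e = "\<lambda>x. exp (- \<i> * of_real x * of_real p)"
  let ?h = "\<lambda>x. f' x * ?e x - \<i> * of_real p * (f x * ?e x)"
  have int: "integrable lborel (\<lambda>x. f' x * ?e x)" "integrable lborel (\<lambda>x. f x * ?e x)"
    using fourier_integrand_integrable integrable_schwartz f f' by blast+
  have e: "(?e has_vector_derivative - \<i> * of_real p * ?e x) (at x)" for x
  proof -
    have "((\<lambda>z. exp (- \<i> * z * of_real p)) has_field_derivative - \<i> * of_real p * ?e x) (at (of_real x))"
      by (auto intro!: derivative_eq_intros)
    from has_vector_derivative_real_field[OF this] show ?thesis by simp
  qed
  have d: "((\<lambda>x. f x * ?e x) has_vector_derivative ?h x) (at x)" for x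
    using has_vector_derivative_mult[OF f'(2) e, of x] by (simp add: mult_ac)
  have lim: "((\<lambda>x. f x * ?e x) \<longlongrightarrow> 0) at_infinity"
    using tendsto_norm_zero[OF tendsto_schwartz_infinity[OF f]]
    by (subst tendsto_norm_zero_iff[symmetric]) (simp add: norm_mult)
  have "(LBINT x=-\<infinity>..\<infinity>. ?h x) = 0 - 0"
  proof (rule interval_integral_FTC_integrable)
    show "set_integrable lborel (einterval (-\<infinity>) \<infinity>) ?h"
      using int by (simp add: set_integrable_def)
    show "isCont ?h x" for x
      using schwartz_continuous f f' by (intro continuous_intros) auto
    show "(((\<lambda>x. f x * ?e x) \<circ> real_of_ereal) \<longlongrightarrow> 0) (at_right (-\<infinity>))"
      using lim by (simp add: ereal_tendsto_simps filterlim_mono[OF _ order_refl at_bot_le_at_infinity])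
    show "(((\<lambda>x. f x * ?e x) \<circ> real_of_ereal) \<longlongrightarrow> 0) (at_left \<infinity>)"
      using lim by (simp add: ereal_tendsto_simps filterlim_mono[OF _ order_refl at_top_le_at_infinity])
  qed (use d in auto)
  then have "(CLBINT x. ?h x) = 0"
    by (simp add: interval_lebesgue_integral_def set_lebesgue_integral_def)
  then show ?thesis
    using int by (simp add: fourier_def)
qed

text \<open>
  The Fourier transforms of Schwartz functions form a class to which coinduction applies: differentiation
  corresponds to multiplying \<open>f\<close> by \<open>- \<i> x\<close>, and a factor \<open>p\<close> to differentiating \<open>f\<close>.
\<close>

lemma schwartz_fourier:
  assumes "schwartz f"
  shows "schwartz (fourier f)"
proof (rule schwartz_coinduct[where X = "{fourier f |f. schwartz f}"])
  fix q assume "q \<in> {fourier f |f. schwartz f}"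
  then obtain f where [simp]: "q = fourier f" and f: "schwartz f" by auto
  show "\<exists>h\<in>{fourier f |f. schwartz f}. \<forall>x. (q has_vector_derivative h x) (at x)"
  proof (rule bexI[of _ "fourier (\<lambda>x. - \<i> * (of_real x * f x))"])
    show "\<forall>x. (q has_vector_derivative fourier (\<lambda>x. - \<i> * (of_real x * f x)) x) (at x)"
      using fourier_derivative[OF f] by simp
  qed (use schwartz_cmult[OF schwartz_times_of_real[OF f], of "- \<i>"] in blast)
next
  fix q k assume "q \<in> {fourier f |f. schwartz f}"
  then obtain f where "q = fourier f" "schwartz f" by auto
  then show "bounded (range (\<lambda>x. x ^ k *\<^sub>R q x))"
  proof (induction k arbitrary: f q)
    case 0
    then show ?case
      using norm_fourier_le[OF integrable_schwartz] by (auto simp: bounded_iff)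
  next
    case (Suc k)
    obtain f' where f': "schwartz f'" "\<And>x. (f has_vector_derivative f' x) (at x)"
      using schwartz_derivative[OF \<open>schwartz f\<close>] by metis
    have "x ^ Suc k *\<^sub>R q x = - \<i> * (x ^ k *\<^sub>R fourier f' x)" for x
      using fourier_of_derivative[OF \<open>schwartz f\<close> f'] Suc.prems
      by (simp add: scaleR_conv_of_real algebra_simps)
    then show ?case
      using Suc.IH[OF refl f'(1)] by (simp add: bounded_iff norm_mult)
  qed
qed (use assms in auto)

section \<open>Gaussians and Parseval's formula\<close>

lemma integrable_gaussian_moment:
  fixes c :: real
  assumes "c > 0"
  shows "integrable lborel (\<lambda>y. y ^ k * exp (- c * y\<^sup>2 / 2))"
proof -
  have "integrable lborel (\<lambda>y. sqrt (2 * pi / c) * (normal_density 0 (1 / sqrt c) y * (y - 0) ^ k))"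
    using assms by (intro integrable_mult_right integrable_normal_moment) auto
  moreover have "sqrt (2 * pi / c) * (normal_density 0 (1 / sqrt c) y * (y - 0) ^ k) = y ^ k * exp (- c * y\<^sup>2 / 2)" for y
    using assms by (simp add: normal_density_def power_divide real_sqrt_divide field_simps)
  ultimately show ?thesis by (simp only:)
qed

lemma gaussian_integrable:
  assumes "Re a > 0"
  shows "integrable lborel (\<lambda>y::real. exp (- a * (of_real y)\<^sup>2 / 2 + \<i> * of_real b * of_real y))"
proof (rule Bochner_Integration.integrable_bound)
  show "integrable lborel (\<lambda>y. y ^ 0 * exp (- Re a * y\<^sup>2 / 2))"
    using assms by (rule integrable_gaussian_moment)
  show "AE y in lborel. norm (exp (- a * (of_real y)\<^sup>2 / 2 + \<i> * of_real b * of_real y))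
      \<le> norm (y ^ 0 * exp (- Re a * y\<^sup>2 / 2))"
    by (simp flip: of_real_power)
qed auto

text \<open>For real \<open>a\<close> this is the characteristic function of the normal distribution, rescaled.\<close>

lemma gaussian_integral_real:
  fixes a b :: real
  assumes "a > 0"
  shows "(CLBINT y. exp (- of_real a * (of_real y)\<^sup>2 / 2 + \<i> * of_real b * of_real y))
    = of_real (sqrt (2 * pi / a)) * exp (- (of_real b)\<^sup>2 / (2 * of_real a))"
proof -
  define t where "t = b / sqrt a"
  have "(CLBINT x. of_real (std_normal_density x) * iexp (t * x)) = of_real (exp (- t\<^sup>2 / 2))"
    using fun_cong[OF char_std_normal_distribution, of t]
    by (simp add: char_def integral_density scaleR_conv_of_real)
  moreover have "(CLBINT x. of_real (std_normal_density x) * iexp (t * x))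
      = sqrt a *\<^sub>R (CLBINT y. of_real (std_normal_density (0 + sqrt a * y)) * iexp (t * (0 + sqrt a * y)))"
    using assms by (subst lborel_integral_real_affine[where c = "sqrt a" and t = 0]) auto
  moreover have "of_real (std_normal_density (0 + sqrt a * y)) * iexp (t * (0 + sqrt a * y))
      = of_real (1 / sqrt (2 * pi)) * exp (- of_real a * (of_real y)\<^sup>2 / 2 + \<i> * of_real b * of_real y)" for y
    using assms
    by (simp add: std_normal_density_def t_def power_mult_distrib mult_exp_exp mult_ac flip: exp_of_real)
  ultimately have "of_real (sqrt a) * (of_real (1 / sqrt (2 * pi)) *
      (CLBINT y. exp (- of_real a * (of_real y)\<^sup>2 / 2 + \<i> * of_real b * of_real y))) = complex_of_real (exp (- t\<^sup>2 / 2))"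
    by (simp add: scaleR_conv_of_real)
  moreover have "complex_of_real (exp (- t\<^sup>2 / 2)) = exp (- (of_real b)\<^sup>2 / (2 * of_real a))"
    using assms by (simp add: t_def power_divide mult.commute flip: exp_of_real)
  moreover have "sqrt a > 0" "sqrt (2 * pi) > 0" using assms by auto
  ultimately show ?thesis
    by (simp add: real_sqrt_divide field_simps)
qed

text \<open>
  Both sides are holomorphic in \<open>a\<close> on the right half-plane and agree on the positive reals, which
  accumulate at 1. The principal square root is the right branch because it is the positive one there.
\<close>

lemma gaussian_integral:
  assumes "Re a > 0"
  shows "(CLBINT y. exp (- a * (of_real y)\<^sup>2 / 2 + \<i> * of_real b * of_real y))
    = of_real (sqrt (2 * pi)) / csqrt a * exp (- (of_real b)\<^sup>2 / (2 * a))"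
proof -
  let ?S = "{z. Re z > 0}"
  let ?I = "\<lambda>a. CLBINT y. exp (- a * (of_real y)\<^sup>2 / 2 + \<i> * of_real b * of_real y)"
  let ?R = "\<lambda>a. of_real (sqrt (2 * pi)) / csqrt a * exp (- (of_real b)\<^sup>2 / (2 * a))"
  have "?I field_differentiable (at z)" if "z \<in> ?S" for z
  proof -
    let ?T = "{w. Re w > Re z / 2}"
    have "(?I has_field_derivative
        (CLBINT y. - (of_real y)\<^sup>2 / 2 * exp (- z * (of_real y)\<^sup>2 / 2 + \<i> * of_real b * of_real y)))
        (at z within ?T)"
    proof (rule has_field_derivative_integral[where h = "\<lambda>y. y\<^sup>2 * exp (- (Re z / 2) * y\<^sup>2 / 2)"])
      show "convex ?T" by (rule convex_halfspace_Re_gt)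
      show "integrable lborel (\<lambda>y::real. exp (- w * (of_real y)\<^sup>2 / 2 + \<i> * of_real b * of_real y))"
        if "w \<in> ?T" for w
        using \<open>w \<in> ?T\<close> \<open>z \<in> ?S\<close> by (intro gaussian_integrable) auto
      show "integrable lborel (\<lambda>y. y\<^sup>2 * exp (- (Re z / 2) * y\<^sup>2 / 2))"
        using \<open>z \<in> ?S\<close> by (intro integrable_gaussian_moment) auto
      show "norm (- (of_real y)\<^sup>2 / 2 * exp (- w * (of_real y)\<^sup>2 / 2 + \<i> * of_real b * of_real y))
          \<le> y\<^sup>2 * exp (- (Re z / 2) * y\<^sup>2 / 2)" if "w \<in> ?T" for y :: real and w
      proof -
        have "norm (- (complex_of_real y)\<^sup>2 / 2 * exp (- w * (of_real y)\<^sup>2 / 2 + \<i> * of_real b * of_real y))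
            = y\<^sup>2 / 2 * exp (- Re w * y\<^sup>2 / 2)"
          by (simp add: norm_mult norm_divide norm_power flip: of_real_power)
        also have "\<dots> \<le> y\<^sup>2 * exp (- (Re z / 2) * y\<^sup>2 / 2)"
          using that mult_right_mono[of "Re z" "Re w * 2" "y\<^sup>2"] by (intro mult_mono) (auto simp: mult_ac)
        finally show ?thesis .
      qed
    qed (use \<open>z \<in> ?S\<close> in \<open>auto intro!: derivative_eq_intros\<close>)
    moreover have "at z within ?T = at z"
      using that by (intro at_within_open open_halfspace_Re_gt) auto
    ultimately show ?thesis by (auto simp: field_differentiable_def)
  qed
  then have "?I holomorphic_on ?S"
    unfolding holomorphic_on_def by (blast intro: field_differentiable_at_within)
  moreover have "?R holomorphic_on ?S"
    by (intro holomorphic_intros) (auto simp: complex_nonpos_Reals_iff)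
  ultimately have "(\<lambda>a. ?I a - ?R a) holomorphic_on ?S"
    by (rule holomorphic_on_diff)
  moreover have "1 islimpt complex_of_real ` {0<..}"
    unfolding islimpt_approachable
  proof (intro allI impI)
    fix e :: real assume "e > 0"
    then show "\<exists>x'\<in>complex_of_real ` {0<..}. x' \<noteq> 1 \<and> dist x' 1 < e"
      by (intro bexI[of _ "of_real (1 + e / 2)"] imageI) (auto simp: dist_norm)
  qed
  moreover have "?I z - ?R z = 0" if "z \<in> complex_of_real ` {0<..}" for z
  proof -
    obtain x where x: "z = complex_of_real x" "x > 0" using \<open>z \<in> _\<close> by auto
    then have "csqrt z = of_real (sqrt x)" by simp
    then show ?thesis
      unfolding x(1) gaussian_integral_real[OF x(2)] by (simp add: real_sqrt_divide)
  qed
  ultimately have "?I a - ?R a = 0"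
    using assms
    by (intro analytic_continuation[of "\<lambda>a. ?I a - ?R a" ?S "complex_of_real ` {0<..}" 1 a])
       (auto intro: open_halfspace_Re_gt convex_connected convex_halfspace_Re_gt)
  then show ?thesis by simp
qed

lemma fourier_parseval_gaussian:
  assumes w: "integrable lborel w" and a: "Re a > 0"
  shows "(CLBINT y. fourier w y * exp (- a * (of_real y)\<^sup>2 / 2 + \<i> * of_real x * of_real y))
    = of_real (sqrt (2 * pi)) / csqrt a * (CLBINT p. w p * exp (- (of_real (x - p))\<^sup>2 / (2 * a)))"
proof -
  let ?G = "\<lambda>b y. exp (- a * (of_real y)\<^sup>2 / 2 + \<i> * of_real b * of_real y)"
  note [measurable] = borel_measurable_integrable[OF w, simplified]
  have "integrable (lborel \<Otimes>\<^sub>M lborel) (\<lambda>z. (w (fst z) * ?G x (snd z)) *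
      exp (- \<i> * of_real (fst z) * of_real (snd z)))"
    by (intro integrable_times_unimodular integrable_tensor[OF _ _ w gaussian_integrable[OF a, of x]])
      (auto intro: lborel.sigma_finite_measure_axioms)
  then have int: "integrable (lborel \<Otimes>\<^sub>M lborel) (\<lambda>(p, y). w p * exp (- \<i> * of_real p * of_real y) * ?G x y)"
    by (rule Bochner_Integration.integrable_cong[THEN iffD1, rotated -1]) (auto simp: mult_ac)
  have "(CLBINT y. fourier w y * ?G x y)
      = (CLBINT y. CLBINT p. w p * exp (- \<i> * of_real p * of_real y) * ?G x y)"
    by (simp add: fourier_def)
  also have "\<dots> = (CLBINT p. CLBINT y. w p * exp (- \<i> * of_real p * of_real y) * ?G x y)"
    by (rule lborel_pair.Fubini_integral[OF int])
  also have "\<dots> = (CLBINT p. CLBINT y. w p * ?G (x - p) y)"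
  proof -
    have "w p * exp (- \<i> * of_real p * of_real y) * ?G x y = w p * ?G (x - p) y" for p y
      unfolding mult.assoc exp_add[symmetric] by (simp add: algebra_simps)
    then show ?thesis by (simp only:)
  qed
  also have "\<dots> = (CLBINT p. w p * (of_real (sqrt (2 * pi)) / csqrt a * exp (- (of_real (x - p))\<^sup>2 / (2 * a))))"
    by (simp only: integral_mult_right_zero gaussian_integral[OF a])
  also have "\<dots> = (CLBINT p. of_real (sqrt (2 * pi)) / csqrt a * (w p * exp (- (of_real (x - p))\<^sup>2 / (2 * a))))"
    by (simp only: mult_ac)
  finally show ?thesis by (simp only: integral_mult_right_zero)
qed

text \<open>
  The Gaussian formula at the boundary \<open>Re a = 0\<close>, approached along \<open>a = 1/(n+1) - \<i> \<tau>\<close>. Integrability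
  of both \<open>w\<close> and its transform provides the dominating functions. Taking moduli discards the phase of
  the square root of \<open>- \<i> \<tau>\<close>.
\<close>

lemma fourier_parseval_chirp:
  assumes w: "integrable lborel w" and Fw: "integrable lborel (fourier w)" and "\<tau> \<noteq> 0"
  shows "norm (CLBINT y. fourier w y * exp (\<i> * of_real (\<tau> * y\<^sup>2 / 2 + x * y)))
    = sqrt (2 * pi / \<bar>\<tau>\<bar>) * norm (CLBINT p. w p * exp (- \<i> * of_real ((x - p)\<^sup>2 / (2 * \<tau>))))"
proof -
  define a where "a = (\<lambda>n. Complex (1 / real (Suc n)) (- \<tau>))"
  have lim: "a \<longlonglongrightarrow> - \<i> * of_real \<tau>"
  proof -
    have "a \<longlonglongrightarrow> Complex 0 (- \<tau>)"
      unfolding a_def by (intro tendsto_Complex tendsto_const LIMSEQ_Suc lim_1_over_n)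
    then show ?thesis by (simp add: complex_eq_iff Complex_eq)
  qed
  have Re_a: "Re (a n) > 0" for n by (simp add: a_def)
  note [measurable] = borel_measurable_integrable[OF w, simplified] fourier_measurable[OF w]
  have "(\<lambda>n. CLBINT y. fourier w y * exp (- a n * (of_real y)\<^sup>2 / 2 + \<i> * of_real x * of_real y))
      \<longlonglongrightarrow> (CLBINT y. fourier w y * exp (- (- \<i> * of_real \<tau>) * (of_real y)\<^sup>2 / 2 + \<i> * of_real x * of_real y))"
  proof (rule integral_dominated_convergence[where w = "\<lambda>y. norm (fourier w y)"])
    show "AE y in lborel. (\<lambda>n. fourier w y * exp (- a n * (of_real y)\<^sup>2 / 2 + \<i> * of_real x * of_real y))
        \<longlonglongrightarrow> fourier w y * exp (- (- \<i> * of_real \<tau>) * (of_real y)\<^sup>2 / 2 + \<i> * of_real x * of_real y)"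
      by (intro AE_I2 tendsto_intros lim)  auto
    show "AE y in lborel. norm (fourier w y * exp (- a n * (of_real y)\<^sup>2 / 2 + \<i> * of_real x * of_real y))
        \<le> norm (fourier w y)" for n
      using Re_a[of n]
      by (intro AE_I2) (auto simp: norm_mult simp flip: of_real_power intro!: mult_left_le)
  qed (use Fw in auto)
  moreover have "(\<lambda>n. of_real (sqrt (2 * pi)) / csqrt (a n) * (CLBINT p. w p * exp (- (of_real (x - p))\<^sup>2 / (2 * a n))))
      \<longlonglongrightarrow> of_real (sqrt (2 * pi)) / csqrt (- \<i> * of_real \<tau>)
        * (CLBINT p. w p * exp (- (of_real (x - p))\<^sup>2 / (2 * (- \<i> * of_real \<tau>))))"
  proof (intro tendsto_mult tendsto_divide tendsto_const)
    show "(\<lambda>n. csqrt (a n)) \<longlonglongrightarrow> csqrt (- \<i> * of_real \<tau>)"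
      by (rule isCont_tendsto_compose[OF continuous_at_csqrt lim])
        (use \<open>\<tau> \<noteq> 0\<close> in \<open>auto simp: complex_nonpos_Reals_iff\<close>)
    show "csqrt (- \<i> * of_real \<tau>) \<noteq> 0" using \<open>\<tau> \<noteq> 0\<close> by simp
    show "(\<lambda>n. CLBINT p. w p * exp (- (of_real (x - p))\<^sup>2 / (2 * a n)))
        \<longlonglongrightarrow> (CLBINT p. w p * exp (- (of_real (x - p))\<^sup>2 / (2 * (- \<i> * of_real \<tau>))))"
    proof (rule integral_dominated_convergence[where w = "\<lambda>y. norm (w y)"])
      show "AE p in lborel. (\<lambda>n. w p * exp (- (of_real (x - p))\<^sup>2 / (2 * a n)))
          \<longlonglongrightarrow> w p * exp (- (of_real (x - p))\<^sup>2 / (2 * (- \<i> * of_real \<tau>)))"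
        using \<open>\<tau> \<noteq> 0\<close> by (intro AE_I2 tendsto_intros lim) auto
      have "norm (exp (- (of_real (x - p))\<^sup>2 / (2 * a n))) \<le> 1" for n p
      proof -
        have "- (of_real (x - p))\<^sup>2 / (2 * a n) = of_real (- ((x - p)\<^sup>2 / 2)) * inverse (a n)"
          by (simp add: field_simps)
        moreover have "Re (inverse (a n)) \<ge> 0" using Re_a[of n] by simp
        moreover have "Re (of_real r * z) = r * Re z" for r z by simp
        ultimately show ?thesis
          by (simp only: norm_exp_eq_Re exp_le_one_iff) (intro mult_nonpos_nonneg, auto)
      qed
      then show "AE p in lborel. norm (w p * exp (- (of_real (x - p))\<^sup>2 / (2 * a n))) \<le> norm (w p)" for n
        by (intro AE_I2) (auto simp: norm_mult intro!: mult_left_le)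
    qed (use w in auto)
  qed
  ultimately have "(CLBINT y. fourier w y * exp (- (- \<i> * of_real \<tau>) * (of_real y)\<^sup>2 / 2 + \<i> * of_real x * of_real y))
    = of_real (sqrt (2 * pi)) / csqrt (- \<i> * of_real \<tau>)
        * (CLBINT p. w p * exp (- (of_real (x - p))\<^sup>2 / (2 * (- \<i> * of_real \<tau>))))"
    unfolding fourier_parseval_gaussian[OF w Re_a] by (rule LIMSEQ_unique)
  moreover have "exp (- (- \<i> * of_real \<tau>) * (of_real y)\<^sup>2 / 2 + \<i> * of_real x * of_real y)
      = exp (\<i> * of_real (\<tau> * y\<^sup>2 / 2 + x * y))" for y :: real
    by (simp add: algebra_simps)
  moreover have "exp (- (of_real (x - p))\<^sup>2 / (2 * (- \<i> * of_real \<tau>)))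
      = exp (- \<i> * of_real ((x - p)\<^sup>2 / (2 * \<tau>)))" for p :: real
  proof -
    have "\<i> * (2 * (- \<i> * of_real \<tau>)) = complex_of_real (2 * \<tau>)" by simp
    then have "- (of_real (x - p))\<^sup>2 / (2 * (- \<i> * of_real \<tau>))
        = (\<i> * - (of_real (x - p))\<^sup>2) / complex_of_real (2 * \<tau>)"
      by (metis complex_i_not_zero mult_divide_mult_cancel_left)
    then show ?thesis by simp
  qed
  moreover have "norm (csqrt (- \<i> * of_real \<tau>)) = sqrt \<bar>\<tau>\<bar>"
    by (simp add: norm_mult)
  ultimately show ?thesis
    by (simp add: norm_mult norm_divide real_sqrt_divide)
qed

section \<open>Endpoint bounds\<close>

text \<open>
  The Plancherel inequality for integrable functions. Damped by \<open>exp (- \<epsilon> p\<^sup>2 / 2)\<close>, the left-hand side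
  becomes the double integral of \<open>g(x) * cnj (g(y)) * k(x - y)\<close> with a positive Gaussian kernel \<open>k\<close> of
  total mass \<open>2 \<pi>\<close>, whatever \<open>\<epsilon>\<close> is. Bounding \<open>|g(x)| |g(y)|\<close> by the mean of the two squares gives the
  estimate uniformly in \<open>\<epsilon>\<close>, and Fatou's lemma removes the damping.
\<close>

lemma fourier_L2_le:
  assumes g: "integrable lborel g"
  shows "(\<integral>\<^sup>+p. ennreal ((norm (fourier g p))\<^sup>2) \<partial>lborel) \<le> ennreal (2 * pi) * (\<integral>\<^sup>+x. ennreal ((norm (g x))\<^sup>2) \<partial>lborel)"
proof -
  note [measurable] = borel_measurable_integrable[OF g, simplified] fourier_measurable[OF g]
  let ?C = "ennreal (2 * pi) * (\<integral>\<^sup>+x. ennreal ((norm (g x))\<^sup>2) \<partial>lborel)"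
  let ?P = "lborel \<Otimes>\<^sub>M lborel :: (real \<times> real) measure"
  interpret PL: pair_sigma_finite ?P "lborel :: real measure"
    by (simp add: pair_sigma_finite_def lborel_pair.sigma_finite_measure_axioms lborel.sigma_finite_measure_axioms)
  have cnj: "integrable lborel (\<lambda>x. cnj (g x))" using g by simp
  have square: "fourier g p * cnj (fourier g p)
      = (\<integral>z. g (fst z) * cnj (g (snd z)) * exp (- \<i> * of_real (fst z - snd z) * of_real p) \<partial>?P)" for p
  proof -
    have "integrable ?P (\<lambda>z. g (fst z) * cnj (g (snd z)) * exp (- \<i> * of_real (fst z - snd z) * of_real p))"
      by (intro integrable_times_unimodular integrable_tensor g cnj)
        (auto intro: lborel.sigma_finite_measure_axioms)
    then have "(\<integral>z. g (fst z) * cnj (g (snd z)) * exp (- \<i> * of_real (fst z - snd z) * of_real p) \<partial>?P)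
      = (CLBINT x. CLBINT y. g x * cnj (g y) * exp (- \<i> * of_real (x - y) * of_real p))"
      by (subst lborel_pair.integral_fst'[symmetric]) auto
    also have "\<dots> = (CLBINT x. CLBINT y. g x * exp (- \<i> * of_real x * of_real p) *
        (cnj (g y * exp (- \<i> * of_real y * of_real p))))"
    proof -
      have "exp (- \<i> * of_real (x - y) * of_real p)
        = exp (- \<i> * of_real x * of_real p) * cnj (exp (- \<i> * of_real y * of_real p))" for x y
        by (simp add: exp_cnj mult_exp_exp algebra_simps)
      then show ?thesis by (simp only: complex_cnj_mult mult_ac)
    qed
    also have "\<dots> = fourier g p * cnj (fourier g p)"
      by (simp only: integral_mult_right_zero integral_mult_left_zero Bochner_Integration.integral_cnj fourier_def)
    finally show ?thesis ..
  qed
  have damped: "(\<integral>\<^sup>+p. ennreal ((norm (fourier g p))\<^sup>2 * exp (- \<epsilon> * p\<^sup>2 / 2)) \<partial>lborel) \<le> ?C"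
    if "\<epsilon> > 0" for \<epsilon>
  proof -
    let ?e = "\<lambda>p. exp (- of_real \<epsilon> * (complex_of_real p)\<^sup>2 / 2)"
    define k where "k = (\<lambda>x. sqrt (2 * pi / \<epsilon>) * exp (- x\<^sup>2 / (2 * \<epsilon>)))"
    have [measurable]: "k \<in> borel_measurable borel" by (simp add: k_def)
    have k0: "k x \<ge> 0" for x using that by (simp add: k_def)
    have k: "(\<integral>\<^sup>+x. ennreal (k x) \<partial>lborel) = ennreal (2 * pi)"
    proof -
      have "k = (\<lambda>x. 2 * pi * normal_density 0 (sqrt \<epsilon>) x)"
        unfolding k_def using that by (intro ext) (simp add: normal_density_def real_sqrt_mult real_sqrt_divide field_simps)
      then have "(\<integral>\<^sup>+x. ennreal (k x) \<partial>lborel) = ennreal (\<integral>x. 2 * pi * normal_density 0 (sqrt \<epsilon>) x \<partial>lborel)"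
        by (subst nn_integral_eq_integral) (use that in auto)
      then show ?thesis using that by simp
    qed
    have split: "ennreal (1/2 * (a\<^sup>2 * k r)) = ennreal (1/2) * ennreal (a\<^sup>2) * ennreal (k r)" for a r
    proof -
      have "ennreal (1/2 * (a\<^sup>2 * k r)) = ennreal (1/2) * ennreal (a\<^sup>2 * k r)"
        by (rule ennreal_mult) (simp_all add: k0)
      also have "ennreal (a\<^sup>2 * k r) = ennreal (a\<^sup>2) * ennreal (k r)"
        by (rule ennreal_mult) (simp_all add: k0)
      finally show ?thesis by (simp only: mult.assoc)
    qed
    have half: "(\<integral>\<^sup>+x. \<integral>\<^sup>+y. ennreal (1/2) * ennreal ((norm (g x))\<^sup>2) * ennreal (k (y - x)) \<partial>lborel \<partial>lborel)
      = ennreal (1/2) * ?C"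
    proof -
      have "(\<integral>\<^sup>+y. ennreal (k (y - x)) \<partial>lborel) = ennreal (2 * pi)" for x
        using nn_integral_real_affine[of "\<lambda>y. ennreal (k y)" 1 "- x"] k by simp
      then show ?thesis by (simp add: nn_integral_cmult nn_integral_multc mult_ac)
    qed
    have e_int: "integrable lborel ?e"
      using gaussian_integrable[of "of_real \<epsilon>" 0] that by simp
    have int: "integrable (?P \<Otimes>\<^sub>M lborel) (\<lambda>(z, p). g (fst z) * cnj (g (snd z)) * ?e p *
        exp (- \<i> * of_real (fst z - snd z) * of_real p))"
    proof -
      have A: "integrable ?P (\<lambda>z. g (fst z) * cnj (g (snd z)))"
        by (intro integrable_tensor g cnj lborel.sigma_finite_measure_axioms)
      have B: "integrable (?P \<Otimes>\<^sub>M lborel) (\<lambda>w. g (fst (fst w)) * cnj (g (snd (fst w))) * ?e (snd w))"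
        using integrable_tensor[OF lborel_pair.sigma_finite_measure_axioms lborel.sigma_finite_measure_axioms A e_int]
        by simp
      have "integrable (?P \<Otimes>\<^sub>M lborel) (\<lambda>w. g (fst (fst w)) * cnj (g (snd (fst w))) * ?e (snd w) *
          exp (- \<i> * of_real (fst (fst w) - snd (fst w)) * of_real (snd w)))"
        using B by (rule integrable_times_unimodular) auto
      then show ?thesis by (simp add: case_prod_beta')
    qed
    have "of_real (\<integral>p. (norm (fourier g p))\<^sup>2 * exp (- \<epsilon> * p\<^sup>2 / 2) \<partial>lborel)
        = (CLBINT p. fourier g p * cnj (fourier g p) * ?e p)"
      unfolding integral_complex_of_real[symmetric] complex_norm_square[symmetric]
      by (intro Bochner_Integration.integral_cong) (auto simp: complex_norm_square simp flip: exp_of_real)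
    also have "\<dots> = (CLBINT p. \<integral>z. g (fst z) * cnj (g (snd z)) * ?e p *
        exp (- \<i> * of_real (fst z - snd z) * of_real p) \<partial>?P)"
    proof (rule Bochner_Integration.integral_cong[OF refl])
      show "fourier g p * cnj (fourier g p) * ?e p = (\<integral>z. g (fst z) * cnj (g (snd z)) * ?e p *
          exp (- \<i> * of_real (fst z - snd z) * of_real p) \<partial>?P)" for p
        unfolding square by (subst integral_mult_left_zero[symmetric]) (simp only: mult_ac)
    qed
    also have "\<dots> = (\<integral>z. (CLBINT p. g (fst z) * cnj (g (snd z)) * ?e p *
        exp (- \<i> * of_real (fst z - snd z) * of_real p)) \<partial>?P)"
      by (rule PL.Fubini_integral[OF int])
    also have "\<dots> = (\<integral>z. g (fst z) * cnj (g (snd z)) * of_real (k (fst z - snd z)) \<partial>?P)"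
    proof (rule Bochner_Integration.integral_cong[OF refl])
      fix z :: "real \<times> real"
      have "(CLBINT p. g (fst z) * cnj (g (snd z)) * ?e p * exp (- \<i> * of_real (fst z - snd z) * of_real p))
        = (CLBINT p. g (fst z) * cnj (g (snd z)) *
            exp (- of_real \<epsilon> * (of_real p)\<^sup>2 / 2 + \<i> * of_real (snd z - fst z) * of_real p))"
        by (simp add: mult.assoc mult_exp_exp algebra_simps)
      also have "\<dots> = g (fst z) * cnj (g (snd z)) * of_real (k (fst z - snd z))"
        unfolding integral_mult_right_zero gaussian_integral_real[OF that]
        by (simp add: k_def power2_commute[of "complex_of_real (snd z)"] flip: exp_of_real)
      finally show "(CLBINT p. g (fst z) * cnj (g (snd z)) * ?e p * exp (- \<i> * of_real (fst z - snd z) * of_real p))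
        = g (fst z) * cnj (g (snd z)) * of_real (k (fst z - snd z))" .
    qed
    finally have eq: "complex_of_real (\<integral>p. (norm (fourier g p))\<^sup>2 * exp (- \<epsilon> * p\<^sup>2 / 2) \<partial>lborel)
      = (\<integral>z. g (fst z) * cnj (g (snd z)) * of_real (k (fst z - snd z)) \<partial>?P)" .
    have "integrable lborel (\<lambda>p. (norm (fourier g p))\<^sup>2 * exp (- \<epsilon> * p\<^sup>2 / 2))"
    proof (rule Bochner_Integration.integrable_bound)
      show "integrable lborel (\<lambda>p. (\<integral>x. norm (g x) \<partial>lborel)\<^sup>2 * (p ^ 0 * exp (- \<epsilon> * p\<^sup>2 / 2)))"
        using that by (intro integrable_mult_right integrable_gaussian_moment)
      show "AE p in lborel. norm ((norm (fourier g p))\<^sup>2 * exp (- \<epsilon> * p\<^sup>2 / 2))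
          \<le> norm ((\<integral>x. norm (g x) \<partial>lborel)\<^sup>2 * (p ^ 0 * exp (- \<epsilon> * p\<^sup>2 / 2)))"
        using norm_fourier_le[OF g] by (intro AE_I2) (auto intro!: mult_right_mono power_mono)
    qed measurable
    then have "(\<integral>\<^sup>+p. ennreal ((norm (fourier g p))\<^sup>2 * exp (- \<epsilon> * p\<^sup>2 / 2)) \<partial>lborel)
        = ennreal (\<integral>p. (norm (fourier g p))\<^sup>2 * exp (- \<epsilon> * p\<^sup>2 / 2) \<partial>lborel)"
      by (intro nn_integral_eq_integral) auto
    also have "\<dots> \<le> ennreal (norm (complex_of_real (\<integral>p. (norm (fourier g p))\<^sup>2 * exp (- \<epsilon> * p\<^sup>2 / 2) \<partial>lborel)))"
      by (simp add: ennreal_leI)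
    also have "\<dots> \<le> (\<integral>\<^sup>+z. norm (g (fst z) * cnj (g (snd z)) * of_real (k (fst z - snd z))) \<partial>?P)"
      unfolding eq
      by (cases "integrable ?P (\<lambda>z. g (fst z) * cnj (g (snd z)) * of_real (k (fst z - snd z)))")
        (auto intro: integral_norm_bound_ennreal simp: not_integrable_integral_eq)
    also have "\<dots> \<le> (\<integral>\<^sup>+z. ennreal (1/2 * ((norm (g (fst z)))\<^sup>2 * k (snd z - fst z))) +
         ennreal (1/2 * ((norm (g (snd z)))\<^sup>2 * k (fst z - snd z))) \<partial>?P)"
    proof (rule nn_integral_mono)
      fix z :: "real \<times> real"
      have "norm (g (fst z)) * norm (g (snd z)) \<le> 1/2 * ((norm (g (fst z)))\<^sup>2 + (norm (g (snd z)))\<^sup>2)"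
        using sum_squares_bound[of "norm (g (fst z))" "norm (g (snd z))"] by simp
      then have "norm (g (fst z)) * norm (g (snd z)) * k (fst z - snd z)
          \<le> 1/2 * ((norm (g (fst z)))\<^sup>2 + (norm (g (snd z)))\<^sup>2) * k (fst z - snd z)"
        using k0 by (rule mult_right_mono)
      moreover have "k (snd z - fst z) = k (fst z - snd z)" by (simp add: k_def power2_commute)
      ultimately have "norm (g (fst z) * cnj (g (snd z)) * of_real (k (fst z - snd z)))
        \<le> 1/2 * ((norm (g (fst z)))\<^sup>2 * k (snd z - fst z)) + 1/2 * ((norm (g (snd z)))\<^sup>2 * k (fst z - snd z))"
        using k0 by (simp add: norm_mult algebra_simps)
      then have "ennreal (norm (g (fst z) * cnj (g (snd z)) * of_real (k (fst z - snd z))))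
        \<le> ennreal (1/2 * ((norm (g (fst z)))\<^sup>2 * k (snd z - fst z)) + 1/2 * ((norm (g (snd z)))\<^sup>2 * k (fst z - snd z)))"
        by (rule ennreal_leI)
      also have "\<dots> = ennreal (1/2 * ((norm (g (fst z)))\<^sup>2 * k (snd z - fst z))) +
         ennreal (1/2 * ((norm (g (snd z)))\<^sup>2 * k (fst z - snd z)))"
        by (rule ennreal_plus) (simp_all add: k0)
      finally show "ennreal (norm (g (fst z) * cnj (g (snd z)) * of_real (k (fst z - snd z))))
        \<le> ennreal (1/2 * ((norm (g (fst z)))\<^sup>2 * k (snd z - fst z))) +
         ennreal (1/2 * ((norm (g (snd z)))\<^sup>2 * k (fst z - snd z)))" .
    qed
    also have "\<dots> = (\<integral>\<^sup>+z. ennreal (1/2 * ((norm (g (fst z)))\<^sup>2 * k (snd z - fst z))) \<partial>?P) +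
         (\<integral>\<^sup>+z. ennreal (1/2 * ((norm (g (snd z)))\<^sup>2 * k (fst z - snd z))) \<partial>?P)"
      by (rule nn_integral_add) auto
    also have "(\<integral>\<^sup>+z. ennreal (1/2 * ((norm (g (fst z)))\<^sup>2 * k (snd z - fst z))) \<partial>?P) = ennreal (1/2) * ?C"
      unfolding half[symmetric]
      by (subst lborel.nn_integral_fst[symmetric]) (simp_all only: split fst_conv snd_conv, measurable)
    also have "(\<integral>\<^sup>+z. ennreal (1/2 * ((norm (g (snd z)))\<^sup>2 * k (fst z - snd z))) \<partial>?P) = ennreal (1/2) * ?C"
      unfolding half[symmetric]
      by (subst lborel_pair.nn_integral_snd[symmetric]) (simp_all only: split fst_conv snd_conv, measurable)
    also have "ennreal (1/2) * ?C + ennreal (1/2) * ?C = ?C"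
    proof -
      have "ennreal (1/2) + ennreal (1/2) = ennreal (1/2 + 1/2)"
        by (rule ennreal_plus[symmetric]) simp_all
      then show ?thesis by (simp only: distrib_right[symmetric]) simp
    qed
    finally show ?thesis .
  qed
  show ?thesis
  proof (rule nn_integral_limit_le)
    show "(\<integral>\<^sup>+p. ennreal ((norm (fourier g p))\<^sup>2 * exp (- (1 / real (Suc n)) * p\<^sup>2 / 2)) \<partial>lborel) \<le> ?C" for n
      by (rule damped) simp
    have "(\<lambda>n. (norm (fourier g p))\<^sup>2 * exp (- (1 / real (Suc n)) * p\<^sup>2 / 2))
      \<longlonglongrightarrow> (norm (fourier g p))\<^sup>2 * exp (- 0 * p\<^sup>2 / 2)" for p
      by (intro tendsto_intros LIMSEQ_Suc[OF lim_1_over_n]) auto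
    then show "(\<lambda>n. ennreal ((norm (fourier g p))\<^sup>2 * exp (- (1 / real (Suc n)) * p\<^sup>2 / 2)))
      \<longlonglongrightarrow> ennreal ((norm (fourier g p))\<^sup>2)" for p
      by (intro tendsto_ennrealI) simp
  qed simp
qed

lemma fourier_pairing_le_L1:
  assumes u: "integrable lborel u" and v: "integrable lborel v"
  shows "norm (CLBINT p. v p * fourier u p) \<le> (\<integral>x. norm (u x) \<partial>lborel) * (\<integral>x. norm (v x) \<partial>lborel)"
proof -
  note [measurable] = fourier_measurable[OF u] borel_measurable_integrable[OF v, simplified]
  let ?U = "\<integral>x. norm (u x) \<partial>lborel"
  have le: "norm (v p * fourier u p) \<le> norm (v p) * ?U" for p
    using norm_fourier_le[OF u, of p] by (simp add: norm_mult mult_left_mono)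
  have U: "integrable lborel (\<lambda>p. norm (v p) * ?U)" using v by simp
  have "norm (CLBINT p. v p * fourier u p) \<le> (\<integral>p. norm (v p * fourier u p) \<partial>lborel)"
    by (rule integral_norm_bound)
  also have "\<dots> \<le> (\<integral>p. norm (v p) * ?U \<partial>lborel)"
    by (intro integral_mono Bochner_Integration.integrable_bound[OF U] le U) (use le in auto)
  finally show ?thesis by (simp add: mult.commute)
qed

lemma fourier_pairing_le_L2:
  assumes u: "integrable lborel u" "integrable lborel (\<lambda>x. (norm (u x))\<^sup>2)"
    and v: "integrable lborel v" "integrable lborel (\<lambda>x. (norm (v x))\<^sup>2)"
  shows "norm (CLBINT p. v p * fourier u p)
    \<le> sqrt (2 * pi) * sqrt ((\<integral>x. (norm (u x))\<^sup>2 \<partial>lborel) * (\<integral>x. (norm (v x))\<^sup>2 \<partial>lborel))"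
proof -
  note [measurable] = fourier_measurable[OF u(1)] borel_measurable_integrable[OF v(1), simplified]
  let ?U = "\<integral>x. (norm (u x))\<^sup>2 \<partial>lborel" and ?V = "\<integral>x. (norm (v x))\<^sup>2 \<partial>lborel"
  have "ennreal (norm (CLBINT p. v p * fourier u p)) \<le> (\<integral>\<^sup>+p. norm (v p * fourier u p) \<partial>lborel)"
    by (cases "integrable lborel (\<lambda>p. v p * fourier u p)")
      (auto intro: integral_norm_bound_ennreal simp: not_integrable_integral_eq)
  then have "(ennreal (norm (CLBINT p. v p * fourier u p)))\<^sup>2 \<le> (\<integral>\<^sup>+p. ennreal (norm (v p)) * ennreal (norm (fourier u p)) \<partial>lborel)\<^sup>2"
    by (intro power_mono) (auto simp: norm_mult ennreal_mult')
  also have "\<dots> \<le> (\<integral>\<^sup>+p. (ennreal (norm (v p)))\<^sup>2 \<partial>lborel) * (\<integral>\<^sup>+p. (ennreal (norm (fourier u p)))\<^sup>2 \<partial>lborel)"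
    by (rule Cauchy_Schwarz_nn_integral) auto
  also have "\<dots> \<le> (\<integral>\<^sup>+p. ennreal ((norm (v p))\<^sup>2) \<partial>lborel) * (ennreal (2 * pi) * (\<integral>\<^sup>+p. ennreal ((norm (u p))\<^sup>2) \<partial>lborel))"
    using fourier_L2_le[OF u(1)] by (intro mult_mono) (auto simp: ennreal_power)
  also have "\<dots> = ennreal ?V * (ennreal (2 * pi) * ennreal ?U)"
    using u v by (subst (1 2) nn_integral_eq_integral) auto
  also have "\<dots> = ennreal (2 * pi * (?U * ?V))"
    by (simp add: mult_ac flip: ennreal_mult)
  finally have "(norm (CLBINT p. v p * fourier u p))\<^sup>2 \<le> 2 * pi * (?U * ?V)"
    by (simp add: ennreal_power ennreal_le_iff)
  then have "norm (CLBINT p. v p * fourier u p) \<le> sqrt (2 * pi * (?U * ?V))"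
    by (rule real_le_rsqrt)
  then show ?thesis by (simp add: real_sqrt_mult)
qed

section \<open>Complex interpolation\<close>

text \<open>
  Hadamard's three lines theorem. Dividing by \<open>M0\<^bsup>1-z\<^esup> M1\<^bsup>z\<^esup>\<close> reduces to boundary values of modulus at
  most 1. The factor \<open>exp (\<epsilon> (z\<^sup>2 - 1))\<close> has modulus at most 1 on the strip and decays for large
  imaginary part, so the maximum principle applies on a tall rectangle; then \<open>\<epsilon>\<close> tends to 0.
\<close>

lemma three_lines:
  fixes f :: "complex \<Rightarrow> complex"
  assumes hol: "f holomorphic_on UNIV"
    and bdd: "\<And>z. 0 \<le> Re z \<Longrightarrow> Re z \<le> 1 \<Longrightarrow> norm (f z) \<le> B"
    and M0: "\<And>z. Re z = 0 \<Longrightarrow> norm (f z) \<le> M0" "M0 > 0"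
    and M1: "\<And>z. Re z = 1 \<Longrightarrow> norm (f z) \<le> M1" "M1 > 0"
    and \<theta>: "0 \<le> \<theta>" "\<theta> \<le> 1"
  shows "norm (f (of_real \<theta>)) \<le> M0 powr (1 - \<theta>) * M1 powr \<theta>"
proof -
  define L where "L = (\<lambda>z :: complex. (1 - z) * of_real (ln M0) + z * of_real (ln M1))"
  define g where "g = (\<lambda>z. f z * exp (- L z))"
  have Re_L: "Re (L z) = (1 - Re z) * ln M0 + Re z * ln M1" for z
    by (simp add: L_def)
  have norm_g: "norm (g z) = norm (f z) * exp (- Re (L z))" for z
    by (simp add: g_def norm_mult)
  have g0: "norm (g z) \<le> 1" if "Re z = 0" for z
    using M0(1)[OF that] M0(2) that by (simp add: norm_g Re_L exp_minus field_simps)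
  have g1: "norm (g z) \<le> 1" if "Re z = 1" for z
    using M1(1)[OF that] M1(2) that by (simp add: norm_g Re_L exp_minus field_simps)
  define K where "K = B * exp (\<bar>ln M0\<bar> + \<bar>ln M1\<bar>)"
  have "B \<ge> 0" using bdd[of 0] norm_ge_zero[of "f 0"] by (simp del: norm_ge_zero)
  have gK: "norm (g z) \<le> K" if "0 \<le> Re z" "Re z \<le> 1" for z
  proof -
    have "\<bar>(1 - Re z) * ln M0\<bar> \<le> \<bar>ln M0\<bar>" "\<bar>Re z * ln M1\<bar> \<le> \<bar>ln M1\<bar>"
      using that by (auto simp: abs_mult intro: mult_left_le_one_le)
    then have "- Re (L z) \<le> \<bar>ln M0\<bar> + \<bar>ln M1\<bar>" by (simp add: Re_L)
    then show ?thesis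
      using bdd[OF that] \<open>B \<ge> 0\<close> by (simp add: norm_g K_def mult_mono)
  qed
  have "K \<ge> 0" using \<open>B \<ge> 0\<close> by (simp add: K_def)
  have damped: "norm (g (of_real \<theta>) * exp (of_real \<epsilon> * ((of_real \<theta>)\<^sup>2 - 1))) \<le> 1" if "\<epsilon> > 0" for \<epsilon>
  proof -
    define h where "h = (\<lambda>z. g z * exp (of_real \<epsilon> * (z\<^sup>2 - 1)))"
    have norm_h: "norm (h z) = norm (g z) * exp (\<epsilon> * ((Re z)\<^sup>2 - (Im z)\<^sup>2 - 1))" for z
      by (simp add: h_def norm_mult power2_eq_square)
    \<comment> \<open>The height is chosen so that \<open>K \<le> \<epsilon> T\<^sup>2\<close>, which makes the damping beat the bound \<open>K\<close>.\<close>
    define T where "T = sqrt (K / \<epsilon>) + 1"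
    have "T > 0" using \<open>K \<ge> 0\<close> \<open>\<epsilon> > 0\<close> by (simp add: T_def add_nonneg_pos)
    have KT: "K * exp (- \<epsilon> * T\<^sup>2) \<le> 1"
    proof -
      have "K / \<epsilon> \<le> T\<^sup>2"
        using \<open>K \<ge> 0\<close> \<open>\<epsilon> > 0\<close> by (simp add: T_def power2_eq_square algebra_simps)
      then have "K \<le> \<epsilon> * T\<^sup>2" using \<open>\<epsilon> > 0\<close> by (simp add: field_simps)
      also have "\<dots> \<le> exp (\<epsilon> * T\<^sup>2)" using exp_ge_add_one_self[of "\<epsilon> * T\<^sup>2"] by linarith
      finally show ?thesis by (simp add: exp_minus field_simps)
    qed
    let ?S = "cbox (Complex 0 (- T)) (Complex 1 T)"
    have hol_h: "h holomorphic_on UNIV"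
      unfolding h_def g_def L_def by (intro holomorphic_intros hol)
    have "norm (h (of_real \<theta>)) \<le> 1"
    proof (rule maximum_modulus_frontier[where f = h and S = ?S])
      show "h holomorphic_on interior ?S" using hol_h by (rule holomorphic_on_subset) simp
      show "continuous_on (closure ?S) h"
        using hol_h by (blast intro: holomorphic_on_imp_continuous_on holomorphic_on_subset)
      show "bounded ?S" by (rule bounded_cbox)
      show "of_real \<theta> \<in> ?S" using \<theta> \<open>T > 0\<close> by (auto simp: in_cbox_complex_iff)
      fix z assume "z \<in> frontier ?S"
      then have z: "0 \<le> Re z" "Re z \<le> 1" "Re z = 0 \<or> Re z = 1 \<or> \<bar>Im z\<bar> = T"
        using \<open>T > 0\<close>
        by (auto simp: frontier_def interior_cbox in_cbox_complex_iff in_box_complex_iff)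
      then have sq: "(Re z)\<^sup>2 \<le> 1" by (simp add: power_le_one)
      consider "norm (g z) \<le> 1" | "\<bar>Im z\<bar> = T" using z(3) g0 g1 by blast
      then show "norm (h z) \<le> 1"
      proof cases
        case 1
        have "(Re z)\<^sup>2 - (Im z)\<^sup>2 \<le> 1" using sq zero_le_power2[of "Im z"] by linarith
        then have "exp (\<epsilon> * ((Re z)\<^sup>2 - (Im z)\<^sup>2 - 1)) \<le> 1"
          using \<open>\<epsilon> > 0\<close> by (simp add: mult_le_0_iff)
        with 1 show ?thesis by (simp add: norm_h mult_le_one)
      next
        case 2
        then have "(Im z)\<^sup>2 = T\<^sup>2" by (metis power2_abs)
        then have "\<epsilon> * ((Re z)\<^sup>2 - (Im z)\<^sup>2 - 1) \<le> - \<epsilon> * T\<^sup>2"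
          using sq \<open>\<epsilon> > 0\<close> by (simp add: algebra_simps)
        then have "norm (h z) \<le> K * exp (- \<epsilon> * T\<^sup>2)"
          using gK[OF z(1,2)] \<open>K \<ge> 0\<close> by (simp add: norm_h mult_mono)
        with KT show ?thesis by linarith
      qed
    qed
    then show ?thesis by (simp add: h_def)
  qed
  have "norm (g (of_real \<theta>) * exp (of_real 0 * ((of_real \<theta>)\<^sup>2 - 1))) \<le> 1"
  proof (rule tendsto_upperbound)
    show "((\<lambda>\<epsilon>. norm (g (of_real \<theta>) * exp (of_real \<epsilon> * ((of_real \<theta>)\<^sup>2 - 1))))
      \<longlongrightarrow> norm (g (of_real \<theta>) * exp (of_real 0 * ((of_real \<theta>)\<^sup>2 - 1)))) (at_right 0)"
      by (intro tendsto_intros)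
    show "\<forall>\<^sub>F \<epsilon> in at_right 0. norm (g (of_real \<theta>) * exp (of_real \<epsilon> * ((of_real \<theta>)\<^sup>2 - 1))) \<le> 1"
      using damped by (auto simp: eventually_at_right_field intro!: exI[of _ 1])
  qed simp
  then have "norm (f (of_real \<theta>)) \<le> exp (Re (L (of_real \<theta>)))"
    by (simp add: norm_g exp_minus field_simps)
  then show ?thesis
    using M0(2) M1(2) by (simp add: Re_L powr_def exp_add)
qed

lemma holomorphic_integral_exp:
  fixes c :: "'a \<Rightarrow> complex" and L :: "'a \<Rightarrow> real"
  assumes c: "integrable M c" and [measurable]: "L \<in> borel_measurable M" and L: "\<And>x. \<bar>L x\<bar> \<le> B"
  shows "(\<lambda>z. \<integral>x. c x * exp (z * of_real (L x)) \<partial>M) holomorphic_on UNIV"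
proof -
  note [measurable] = borel_measurable_integrable[OF c]
  have "B \<ge> 0" using L[of undefined] by linarith
  have "(\<lambda>z. \<integral>x. c x * exp (z * of_real (L x)) \<partial>M) field_differentiable (at z)" for z
  proof -
    have bound: "norm (exp (w * of_real (L x))) \<le> exp ((norm z + 1) * B)" if "w \<in> ball z 1" for w x
    proof -
      have "Re w * L x \<le> \<bar>Re w\<bar> * \<bar>L x\<bar>"
        by (metis abs_ge_self abs_mult)
      also have "\<dots> \<le> norm w * B"
        using L[of x] abs_Re_le_cmod[of w] by (intro mult_mono) auto
      also have "norm w \<le> norm z + 1"
        using that norm_triangle_ineq2[of w z] by (simp add: dist_norm norm_minus_commute)
      finally show ?thesis using \<open>B \<ge> 0\<close> by (simp add: mult_right_mono)
    qed
    have "((\<lambda>z. \<integral>x. c x * exp (z * of_real (L x)) \<partial>M) has_field_derivative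
        (\<integral>x. c x * of_real (L x) * exp (z * of_real (L x)) \<partial>M)) (at z within ball z 1)"
    proof (rule has_field_derivative_integral[where h = "\<lambda>x. norm (c x) * (B * exp ((norm z + 1) * B))"])
      show "integrable M (\<lambda>x. c x * exp (w * of_real (L x)))" if "w \<in> ball z 1" for w
      proof (rule Bochner_Integration.integrable_bound)
        show "integrable M (\<lambda>x. norm (c x) * exp ((norm z + 1) * B))" using c by simp
        show "AE x in M. norm (c x * exp (w * of_real (L x))) \<le> norm (norm (c x) * exp ((norm z + 1) * B))"
          using bound[OF that] by (intro AE_I2) (auto simp: norm_mult intro!: mult_left_mono)
      qed auto
      show "norm (c x * of_real (L x) * exp (w * of_real (L x))) \<le> norm (c x) * (B * exp ((norm z + 1) * B))"
        if "w \<in> ball z 1" for x w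
      proof -
        have "norm (of_real (L x) * exp (w * of_real (L x))) \<le> B * exp ((norm z + 1) * B)"
          unfolding norm_mult using bound[OF that, of x] L[of x] \<open>B \<ge> 0\<close> by (intro mult_mono) auto
        then show ?thesis by (simp only: mult.assoc norm_mult[of "c x"] mult_left_mono norm_ge_zero)
      qed
    qed (use c in \<open>auto intro!: derivative_eq_intros\<close>)
    then show ?thesis
      by (auto simp: field_differentiable_def at_within_open[of z "ball z 1"])
  qed
  then show ?thesis by (simp add: holomorphic_on_def field_differentiable_at_within)
qed

text \<open>
  The lower cutoff on the modulus keeps \<open>ln (norm (f x))\<close> bounded, which the interpolating families
  below require. A cutoff by support and size alone would allow values close to 0.
\<close>

definition truncation :: "real \<Rightarrow> (real \<Rightarrow> complex) \<Rightarrow> real \<Rightarrow> complex" where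
  "truncation N f x = (if \<bar>x\<bar> \<le> N \<and> 1 / N \<le> norm (f x) \<and> norm (f x) \<le> N then f x else 0)"

lemma truncation_measurable [measurable]:
  assumes [measurable]: "f \<in> borel_measurable borel"
  shows "truncation N f \<in> borel_measurable borel"
  unfolding truncation_def[abs_def] by measurable

lemma norm_truncation_le: "norm (truncation N f x) \<le> norm (f x)"
  by (simp add: truncation_def)

lemma truncation_tendsto: "(\<lambda>n. truncation (real (Suc n)) f x) \<longlonglongrightarrow> f x"
proof (cases "f x = 0")
  case True
  then have "truncation (real (Suc n)) f x = f x" for n by (simp add: truncation_def)
  then show ?thesis by simp
next
  case False
  define m where "m = Max {\<bar>x\<bar>, norm (f x), 1 / norm (f x)}"
  have m: "\<bar>x\<bar> \<le> m" "norm (f x) \<le> m" "1 / norm (f x) \<le> m" by (auto simp: m_def)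
  have "truncation (real (Suc n)) f x = f x" if "n \<ge> nat \<lceil>m\<rceil>" for n
  proof -
    have "m \<le> real (Suc n)" using that by linarith
    with m have "\<bar>x\<bar> \<le> real (Suc n)" "norm (f x) \<le> real (Suc n)" "1 / norm (f x) \<le> real (Suc n)"
      by linarith+
    moreover from this(3) have "1 / real (Suc n) \<le> norm (f x)"
      using False by (simp add: field_simps)
    ultimately show ?thesis by (simp add: truncation_def)
  qed
  then have "\<forall>\<^sub>F n in sequentially. truncation (real (Suc n)) f x = f x"
    unfolding eventually_sequentially by blast
  then show ?thesis by (rule tendsto_eventually)
qed

text \<open>
  The analytic family through \<open>w\<close>: a number with the argument of \<open>w\<close> and the modulus
  \<open>norm w powr (q / 2 * (1 + Re z))\<close>, up to a phase that depends on \<open>Im z\<close>. Applied to \<open>f \<in> L\<^sup>q\<close>, it gives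
  functions in \<open>L\<^sup>2\<close> on the line \<open>Re z = 0\<close>, functions in \<open>L\<^sup>1\<close> on \<open>Re z = 1\<close>, and \<open>f\<close> itself at
  \<open>z = 2/q - 1\<close>. The value at \<open>w = 0\<close> is 0 because \<open>sgn 0 = 0\<close>.
\<close>

definition phase_power :: "real \<Rightarrow> complex \<Rightarrow> complex \<Rightarrow> complex" where
  "phase_power q z w = sgn w * exp ((1 + z) * of_real (q / 2 * ln (norm w)))"

lemma phase_power_measurable [measurable]:
  assumes [measurable]: "f \<in> borel_measurable M"
  shows "(\<lambda>x. phase_power q z (f x)) \<in> borel_measurable M"
  unfolding phase_power_def sgn_div_norm by measurable

lemma norm_phase_power: "norm (phase_power q z w) = norm w powr (q / 2 * (1 + Re z))"
  by (cases "w = 0") (simp_all add: phase_power_def norm_mult norm_sgn powr_def mult_ac)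

lemma phase_power_self:
  assumes "q > 0"
  shows "phase_power q (of_real (2 / q - 1)) w = w"
proof (cases "w = 0")
  case False
  have "(1 + of_real (2 / q - 1)) * of_real (q / 2 * ln (norm w))
      = complex_of_real ((1 + (2 / q - 1)) * (q / 2 * ln (norm w)))"
    by (simp only: of_real_mult of_real_add of_real_1)
  also have "(1 + (2 / q - 1)) * (q / 2 * ln (norm w)) = ln (norm w)" using assms by simp
  finally have "(1 + of_real (2 / q - 1)) * of_real (q / 2 * ln (norm w)) = complex_of_real (ln (norm w))" .
  then have "phase_power q (of_real (2 / q - 1)) w = sgn w * of_real (exp (ln (norm w)))"
    by (simp only: phase_power_def exp_of_real)
  also have "\<dots> = w" using False by (simp add: sgn_div_norm scaleR_conv_of_real)
  finally show ?thesis .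
qed (simp add: phase_power_def)

lemma integrable_of_bounded_support:
  fixes f :: "real \<Rightarrow> 'a::{banach, second_countable_topology}"
  assumes [measurable]: "f \<in> borel_measurable borel" and "\<And>x. norm (f x) \<le> B" "\<And>x. \<bar>x\<bar> > N \<Longrightarrow> f x = 0"
  shows "integrable lborel f"
proof (rule Bochner_Integration.integrable_bound)
  show "integrable lborel (\<lambda>x. B * indicator {-N..N} x)"
    by (intro integrable_mult_right integrable_real_indicator) (auto simp: emeasure_lborel_Icc_eq)
  have "norm (f x) \<le> norm (B * indicator {-N..N} x)" for x
    using assms(2)[of x] assms(3)[of x] norm_ge_zero[of "f x"]
    by (cases "\<bar>x\<bar> \<le> N") (auto simp: indicator_def abs_le_iff)
  then show "AE x in lborel. norm (f x) \<le> norm (B * indicator {-N..N} x)" by simp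
qed simp

text \<open>The case \<open>w = 0\<close> is covered by the convention \<open>ln 0 = 0\<close>.\<close>

lemma abs_ln_norm_le:
  assumes "w \<noteq> 0 \<Longrightarrow> 1 / N \<le> norm w \<and> norm w \<le> N" and "N \<ge> 1"
  shows "\<bar>ln (norm w)\<bar> \<le> ln N"
proof (cases "w = 0")
  case False
  then have "ln (1 / N) \<le> ln (norm w)" "ln (norm w) \<le> ln N"
    using assms by (auto intro!: ln_mono simp del: ln_div)
  then show ?thesis using \<open>N \<ge> 1\<close> by (simp add: ln_div)
qed (use \<open>N \<ge> 1\<close> in simp)

text \<open>
  The pairing \<open>F z\<close> of the two families is bounded by \<open>sqrt (2 \<pi>) * sqrt (A B)\<close> on \<open>Re z = 0\<close> by Plancherel
  and by \<open>A B\<close> on \<open>Re z = 1\<close> by the sup bound, where \<open>A\<close> and \<open>B\<close> are the integrals of \<open>|g|\<^sup>q\<close> and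
  \<open>|h|\<^sup>q\<close>. The three lines theorem at \<open>\<theta> = 2/q - 1\<close> gives the claim. Written over the product space, \<open>F z\<close> is an
  integral of \<open>c * exp (z L)\<close> with \<open>L\<close> bounded, hence entire.
\<close>

lemma fourier_interpolation:
  fixes g h :: "real \<Rightarrow> complex" and N q :: real
  assumes [measurable]: "g \<in> borel_measurable borel" "h \<in> borel_measurable borel"
    and g: "\<And>x. g x \<noteq> 0 \<Longrightarrow> \<bar>x\<bar> \<le> N \<and> 1 / N \<le> norm (g x) \<and> norm (g x) \<le> N"
    and h: "\<And>x. h x \<noteq> 0 \<Longrightarrow> \<bar>x\<bar> \<le> N \<and> 1 / N \<le> norm (h x) \<and> norm (h x) \<le> N"
    and q: "1 \<le> q" "q \<le> 2" and "N \<ge> 1"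
  shows "norm (CLBINT p. h p * fourier g p) \<le> (2 * pi) powr (1 - 1 / q) *
    ((\<integral>x. norm (g x) powr q \<partial>lborel) * (\<integral>x. norm (h x) powr q \<partial>lborel)) powr (1 / q)"
proof -
  define G where "G = (\<lambda>z x. phase_power q z (g x))"
  define H where "H = (\<lambda>z x. phase_power q z (h x))"
  define A where "A = (\<integral>x. norm (g x) powr q \<partial>lborel)"
  define B where "B = (\<integral>x. norm (h x) powr q \<partial>lborel)"
  define \<theta> where "\<theta> = 2 / q - 1"
  have \<theta>: "0 \<le> \<theta>" "\<theta> \<le> 1" using q by (auto simp: \<theta>_def field_simps)
  have [measurable]: "G z \<in> borel_measurable borel" "H z \<in> borel_measurable borel" for z
    unfolding G_def H_def by measurable
  have powr_int: "integrable lborel (\<lambda>x. norm (f x) powr s)"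
    if [measurable]: "f \<in> borel_measurable borel" and f: "\<And>x. f x \<noteq> 0 \<Longrightarrow> \<bar>x\<bar> \<le> N \<and> 1 / N \<le> norm (f x) \<and> norm (f x) \<le> N"
    for f :: "real \<Rightarrow> complex" and s
  proof (rule integrable_of_bounded_support)
    show "norm (norm (f x) powr s) \<le> exp (\<bar>s\<bar> * ln N)" for x
    proof (cases "f x = 0")
      case False
      have "\<bar>ln (norm (f x))\<bar> \<le> ln N" using f \<open>N \<ge> 1\<close> by (intro abs_ln_norm_le) auto
      then have "\<bar>s * ln (norm (f x))\<bar> \<le> \<bar>s\<bar> * ln N" by (simp add: abs_mult mult_left_mono)
      then show ?thesis using False by (simp add: powr_def)
    qed simp
    show "norm (f x) powr s = 0" if "\<bar>x\<bar> > N" for x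
      using f[of x] that by (cases "f x = 0") auto
  qed measurable
  have G_int: "integrable lborel (G z)" "integrable lborel (\<lambda>x. norm (G z x))"
    "integrable lborel (\<lambda>x. (norm (G z x))\<^sup>2)"
    and H_int: "integrable lborel (H z)" "integrable lborel (\<lambda>x. norm (H z x))"
    "integrable lborel (\<lambda>x. (norm (H z x))\<^sup>2)" for z
  proof -
    have sq: "(y powr s)\<^sup>2 = y powr (2 * s)" for y s :: real
      by (simp add: powr_add[symmetric] power2_eq_square)
    have *: "integrable lborel (\<lambda>x. norm (G z x))" "integrable lborel (\<lambda>x. norm (H z x))"
      using powr_int[of g, OF _ g] powr_int[of h, OF _ h] by (auto simp: G_def H_def norm_phase_power)
    then show "integrable lborel (\<lambda>x. norm (G z x))" "integrable lborel (\<lambda>x. norm (H z x))" by auto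
    from * show "integrable lborel (G z)" "integrable lborel (H z)"
      by (auto intro: integrable_norm_cancel)
    show "integrable lborel (\<lambda>x. (norm (G z x))\<^sup>2)" "integrable lborel (\<lambda>x. (norm (H z x))\<^sup>2)"
      using powr_int[of g, OF _ g] powr_int[of h, OF _ h] by (auto simp: G_def H_def norm_phase_power sq)
  qed
  define F where "F = (\<lambda>z. CLBINT p. H z p * fourier (G z) p)"
  let ?P = "lborel \<Otimes>\<^sub>M lborel :: (real \<times> real) measure"
  define c where "c = (\<lambda>w. G 0 (fst w) * H 0 (snd w) * exp (- \<i> * of_real (fst w) * of_real (snd w)))"
  define L where "L = (\<lambda>w. q / 2 * (ln (norm (g (fst w))) + ln (norm (h (snd w)))))"
  have c_int: "integrable ?P c"
    unfolding c_def
    by (intro integrable_times_unimodular integrable_tensor G_int H_int lborel.sigma_finite_measure_axioms) auto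
  have [measurable]: "L \<in> borel_measurable ?P" unfolding L_def by measurable
  have L_bound: "\<bar>L w\<bar> \<le> 2 * ln N" for w
  proof -
    have "\<bar>ln (norm (g (fst w)))\<bar> \<le> ln N" "\<bar>ln (norm (h (snd w)))\<bar> \<le> ln N"
      using g h \<open>N \<ge> 1\<close> by (auto intro!: abs_ln_norm_le)
    then have "\<bar>ln (norm (g (fst w))) + ln (norm (h (snd w)))\<bar> \<le> 2 * ln N"
      by linarith
    then have "q / 2 * \<bar>ln (norm (g (fst w))) + ln (norm (h (snd w)))\<bar> \<le> 1 * (2 * ln N)"
      using q by (intro mult_mono) auto
    then show ?thesis using q by (simp add: L_def abs_mult)
  qed
  have F_eq: "F z = (\<integral>w. c w * exp (z * of_real (L w)) \<partial>?P)" for z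
  proof -
    have split: "c w * exp (z * of_real (L w))
      = G z (fst w) * H z (snd w) * exp (- \<i> * of_real (fst w) * of_real (snd w))" for w
      by (simp add: c_def L_def G_def H_def phase_power_def algebra_simps add_divide_distrib exp_add)
    have int: "integrable ?P (\<lambda>(x, p). G z x * H z p * exp (- \<i> * of_real x * of_real p))"
      using integrable_times_unimodular[OF integrable_tensor[OF lborel.sigma_finite_measure_axioms
          lborel.sigma_finite_measure_axioms G_int(1)[of z] H_int(1)[of z]],
          of "\<lambda>w. exp (- \<i> * of_real (fst w) * of_real (snd w))"]
      by (simp add: case_prod_beta')
    have "F z = (CLBINT p. CLBINT x. G z x * H z p * exp (- \<i> * of_real x * of_real p))"
      unfolding F_def fourier_def integral_mult_right_zero[symmetric] by (simp only: mult_ac)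
    also have "\<dots> = (\<integral>w. (case w of (x, p) \<Rightarrow> G z x * H z p * exp (- \<i> * of_real x * of_real p)) \<partial>?P)"
      using int by (rule lborel_pair.integral_snd)
    also have "\<dots> = (\<integral>w. c w * exp (z * of_real (L w)) \<partial>?P)"
      by (simp only: split case_prod_beta')
    finally show ?thesis .
  qed
  have hol: "F holomorphic_on UNIV"
    unfolding F_eq[abs_def] using c_int L_bound by (intro holomorphic_integral_exp) auto
  have bdd: "norm (F z) \<le> (\<integral>w. norm (c w) * exp (2 * ln N) \<partial>?P)" if "0 \<le> Re z" "Re z \<le> 1" for z
  proof -
    have le: "norm (c w * exp (z * of_real (L w))) \<le> norm (c w) * exp (2 * ln N)" for w
    proof -
      have "Re z * L w \<le> \<bar>Re z\<bar> * \<bar>L w\<bar>" by (metis abs_ge_self abs_mult)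
      also have "\<dots> \<le> 1 * (2 * ln N)"
        using that L_bound[of w] by (intro mult_mono) auto
      finally have "Re z * L w \<le> 2 * ln N" by simp
      then show ?thesis by (simp add: norm_mult mult_left_mono)
    qed
    have int: "integrable ?P (\<lambda>w. norm (c w) * exp (2 * ln N))" using c_int by simp
    note [measurable] = borel_measurable_integrable[OF c_int]
    have "norm (F z) \<le> (\<integral>w. norm (c w * exp (z * of_real (L w))) \<partial>?P)"
      unfolding F_eq by (rule integral_norm_bound)
    also have "\<dots> \<le> (\<integral>w. norm (c w) * exp (2 * ln N) \<partial>?P)"
      by (intro integral_mono Bochner_Integration.integrable_bound[OF int] le int) (use le in auto)
    finally show ?thesis .
  qed
  have F0: "norm (F z) \<le> sqrt (2 * pi) * sqrt (A * B)" if "Re z = 0" for z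
  proof -
    have sq: "(y powr (q / 2))\<^sup>2 = y powr q" for y :: real
      by (simp add: powr_add[symmetric] power2_eq_square)
    show ?thesis
      using fourier_pairing_le_L2[OF G_int(1,3) H_int(1,3), of z z] that
      by (simp add: F_def A_def B_def G_def H_def norm_phase_power sq)
  qed
  have F1: "norm (F z) \<le> A * B" if "Re z = 1" for z
    using fourier_pairing_le_L1[OF G_int(1) H_int(1), of z z] that
    by (simp add: F_def A_def B_def G_def H_def norm_phase_power)
  have F\<theta>: "F (of_real \<theta>) = (CLBINT p. h p * fourier g p)"
    using phase_power_self[of q] q by (simp add: F_def G_def H_def \<theta>_def)
  have AB: "A \<ge> 0" "B \<ge> 0" by (simp_all add: A_def B_def)
  show ?thesis
  proof (cases "A * B = 0")
    case True
    \<comment> \<open>The three lines theorem needs positive bounds; here one of the functions vanishes almost everywhere.\<close>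
    have "norm (CLBINT p. h p * fourier g p) \<le> (\<integral>x. norm (g x) \<partial>lborel) * (\<integral>x. norm (h x) \<partial>lborel)"
      using fourier_pairing_le_L1[OF G_int(1) H_int(1), of "of_real \<theta>" "of_real \<theta>"] phase_power_self[of q] q
      by (simp add: G_def H_def \<theta>_def)
    also have "\<dots> = 0"
    proof -
      have null: "(\<integral>x. norm (f x) \<partial>lborel) = 0"
        if "(\<integral>x. norm (f x) powr q \<partial>lborel) = 0" "integrable lborel (\<lambda>x. norm (f x) powr q)" for f :: "real \<Rightarrow> complex"
      proof -
        have "AE x in lborel. norm (f x) powr q = 0"
          using that by (subst (asm) integral_nonneg_eq_0_iff_AE) auto
        then have "AE x in lborel. norm (f x) = 0" by eventually_elim simp
        then show ?thesis by (simp add: integral_eq_zero_AE)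
      qed
      show ?thesis
        using True null[of g] null[of h] powr_int[of g, OF _ g] powr_int[of h, OF _ h]
        by (auto simp: A_def B_def)
    qed
    finally show ?thesis using True by (simp add: A_def B_def)
  next
    case False
    with AB have pos: "A * B > 0" by (simp add: less_le)
    have "norm (F (of_real \<theta>)) \<le> (sqrt (2 * pi) * sqrt (A * B)) powr (1 - \<theta>) * (A * B) powr \<theta>"
      by (rule three_lines[OF hol bdd F0 _ F1 _ \<theta>]) (use pos in auto)
    also have "\<dots> = (2 * pi) powr ((1 - \<theta>) / 2) * (A * B) powr ((1 - \<theta>) / 2 + \<theta>)"
      using pos by (simp add: powr_half_sqrt[symmetric] powr_mult powr_powr powr_add)
    also have "(1 - \<theta>) / 2 = 1 - 1 / q" by (simp add: \<theta>_def field_simps)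
    also have "1 - 1 / q + \<theta> = 1 / q" by (simp add: \<theta>_def)
    finally show ?thesis by (simp add: F\<theta> A_def B_def)
  qed
qed

text \<open>Truncations of \<open>g\<close> converge to \<open>g\<close> in \<open>L\<^sup>1\<close>, so their Fourier transforms converge.\<close>

lemma fourier_pairing_le:
  fixes g h :: "real \<Rightarrow> complex" and N q :: real
  assumes g: "integrable lborel g" "integrable lborel (\<lambda>x. norm (g x) powr q)"
    and [measurable]: "h \<in> borel_measurable borel"
    and q: "1 \<le> q" "q \<le> 2" and "N \<ge> 1"
  shows "norm (CLBINT p. truncation N h p * fourier g p) \<le> (2 * pi) powr (1 - 1 / q) *
    ((\<integral>x. norm (g x) powr q \<partial>lborel) * (\<integral>x. norm (truncation N h x) powr q \<partial>lborel)) powr (1 / q)"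
    (is "_ \<le> ?C")
proof (rule LIMSEQ_le_const2)
  note [measurable] = borel_measurable_integrable[OF g(1), simplified] fourier_measurable[OF g(1)]
  define G where "G = (\<lambda>n. truncation (real (Suc n)) g)"
  have [measurable]: "G n \<in> borel_measurable borel" for n by (simp add: G_def)
  have norm_G: "norm (G n x) \<le> norm (g x)" for n x by (simp add: G_def norm_truncation_le)
  have G_lim: "(\<lambda>n. G n x) \<longlonglongrightarrow> g x" for x unfolding G_def by (rule truncation_tendsto)
  have G_int: "integrable lborel (G n)" for n
    by (rule Bochner_Integration.integrable_bound[OF g(1)]) (use norm_G in auto)
  note [measurable] = fourier_measurable[OF G_int]
  have FG_lim: "(\<lambda>n. fourier (G n) p) \<longlonglongrightarrow> fourier g p" for p
    unfolding fourier_def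
  proof (rule integral_dominated_convergence[where w = "\<lambda>x. norm (g x)"])
    show "AE x in lborel. (\<lambda>n. G n x * exp (- \<i> * of_real x * of_real p)) \<longlonglongrightarrow> g x * exp (- \<i> * of_real x * of_real p)"
      by (intro AE_I2 tendsto_intros G_lim)
    show "AE x in lborel. norm (G n x * exp (- \<i> * of_real x * of_real p)) \<le> norm (g x)" for n
      by (intro AE_I2) (simp add: norm_mult norm_G)
  qed (use g in auto)
  have h_int: "integrable lborel (truncation N h)"
    by (rule integrable_of_bounded_support[where B = N and N = N]) (use \<open>N \<ge> 1\<close> in \<open>auto simp: truncation_def\<close>)
  show "(\<lambda>n. norm (CLBINT p. truncation N h p * fourier (G n) p))
      \<longlonglongrightarrow> norm (CLBINT p. truncation N h p * fourier g p)"
  proof (intro tendsto_norm integral_dominated_convergence[where w = "\<lambda>p. norm (truncation N h p) * (\<integral>x. norm (g x) \<partial>lborel)"])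
    show "AE p in lborel. (\<lambda>n. truncation N h p * fourier (G n) p) \<longlonglongrightarrow> truncation N h p * fourier g p"
      by (intro AE_I2 tendsto_intros FG_lim)
    show "AE p in lborel. norm (truncation N h p * fourier (G n) p) \<le> norm (truncation N h p) * (\<integral>x. norm (g x) \<partial>lborel)" for n
    proof (rule AE_I2)
      fix p
      have "norm (fourier (G n) p) \<le> (\<integral>x. norm (G n x) \<partial>lborel)" by (rule norm_fourier_le[OF G_int])
      also have "\<dots> \<le> (\<integral>x. norm (g x) \<partial>lborel)"
        by (intro integral_mono norm_G integrable_norm G_int g)
      finally show "norm (truncation N h p * fourier (G n) p) \<le> norm (truncation N h p) * (\<integral>x. norm (g x) \<partial>lborel)"
        by (simp add: norm_mult mult_left_mono)
    qed
  qed (use h_int in auto)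
  show "\<exists>M. \<forall>n\<ge>M. norm (CLBINT p. truncation N h p * fourier (G n) p) \<le> ?C"
  proof (intro exI allI impI)
    fix n :: nat
    let ?h = "truncation N h" and ?M = "max N (real (Suc n))"
    have M: "1 / ?M \<le> 1 / N" "1 / ?M \<le> 1 / real (Suc n)"
      using \<open>N \<ge> 1\<close> by (auto intro!: divide_left_mono)
    have "norm (CLBINT p. ?h p * fourier (G n) p) \<le> (2 * pi) powr (1 - 1 / q) *
      ((\<integral>x. norm (G n x) powr q \<partial>lborel) * (\<integral>x. norm (?h x) powr q \<partial>lborel)) powr (1 / q)"
    proof (rule fourier_interpolation[where N = ?M])
      show "\<bar>x\<bar> \<le> ?M \<and> 1 / ?M \<le> norm (G n x) \<and> norm (G n x) \<le> ?M" if "G n x \<noteq> 0" for x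
        using that M(2) by (auto simp: G_def truncation_def split: if_splits simp del: of_nat_Suc)
      show "\<bar>x\<bar> \<le> ?M \<and> 1 / ?M \<le> norm (?h x) \<and> norm (?h x) \<le> ?M" if "?h x \<noteq> 0" for x
        using that M(1) by (auto simp: truncation_def split: if_splits simp del: of_nat_Suc)
    qed (use q \<open>N \<ge> 1\<close> in auto)
    also have "\<dots> \<le> ?C"
    proof -
      have "(\<integral>x. norm (G n x) powr q \<partial>lborel) \<le> (\<integral>x. norm (g x) powr q \<partial>lborel)"
      proof (rule integral_mono)
        show le: "norm (G n x) powr q \<le> norm (g x) powr q" for x
          using norm_G[of n x] q by (intro powr_mono2) auto
        show "integrable lborel (\<lambda>x. norm (G n x) powr q)"
          by (rule Bochner_Integration.integrable_bound[OF g(2)]) (use le in auto)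
      qed (rule g(2))
      then show ?thesis
        using q by (intro mult_left_mono powr_mono2 mult_right_mono) auto
    qed
    finally show "norm (CLBINT p. ?h p * fourier (G n) p) \<le> ?C" .
  qed
qed

text \<open>
  Duality. The function \<open>h = cnj (sgn (\<F> g)) * |\<F> g|\<^bsup>p-1\<^esup>\<close> satisfies \<open>h * \<F> g = |\<F> g|\<^sup>p = |h|\<^sup>q\<close>. For the integral \<open>B\<close>
  of \<open>|h|\<^sup>q\<close> over a truncation of \<open>h\<close>, the pairing bound reads \<open>B \<le> C * B\<^bsup>1/q\<^esup>\<close>. As \<open>B\<close> is finite,
  this can be solved for \<open>B\<close>, and Fatou's lemma removes the truncation.
\<close>

lemma hausdorff_young:
  fixes g :: "real \<Rightarrow> complex" and p q :: real
  assumes g: "integrable lborel g" "integrable lborel (\<lambda>x. norm (g x) powr q)"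
    and q: "1 < q" "q \<le> 2" and p: "1 / p + 1 / q = 1"
  shows "(\<integral>\<^sup>+\<xi>. ennreal (norm (fourier g \<xi>) powr p) \<partial>lborel)
    \<le> ennreal (2 * pi * (\<integral>x. norm (g x) powr q \<partial>lborel) powr (p - 1))"
proof -
  note [measurable] = fourier_measurable[OF g(1)]
  have p_eq: "p = q / (q - 1)" and "p \<noteq> 0"
  proof -
    have "1 / p = (q - 1) / q" using p q by (simp add: field_simps)
    then have "1 / (1 / p) = 1 / ((q - 1) / q)" by (simp only:)
    then show "p = q / (q - 1)" by simp
    then show "p \<noteq> 0" using q by simp
  qed
  have "p > 1" using q by (simp add: p_eq field_simps)
  have pq: "(p - 1) * q = p" "p / q = p - 1" "(1 - 1 / q) * p = 1"
    using q by (auto simp: p_eq field_simps)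
  define A where "A = (\<integral>x. norm (g x) powr q \<partial>lborel)"
  have "A \<ge> 0" by (simp add: A_def)
  define h where "h = (\<lambda>\<xi>. cnj (sgn (fourier g \<xi>)) * of_real (norm (fourier g \<xi>) powr (p - 1)))"
  have [measurable]: "h \<in> borel_measurable borel"
  proof -
    have [measurable]: "cnj \<in> borel_measurable borel"
      by (intro borel_measurable_continuous_onI continuous_intros)
    show ?thesis unfolding h_def sgn_div_norm by measurable
  qed
  have norm_h: "norm (h \<xi>) = norm (fourier g \<xi>) powr (p - 1)" for \<xi>
    by (simp add: h_def norm_mult norm_sgn)
  have hF: "h \<xi> * fourier g \<xi> = of_real (norm (h \<xi>) powr q)" for \<xi>
  proof (cases "fourier g \<xi> = 0")
    case False
    have "cnj (sgn (fourier g \<xi>)) * fourier g \<xi> = of_real (norm (fourier g \<xi>))"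
      using False complex_norm_square[of "fourier g \<xi>"]
      by (simp add: sgn_div_norm scaleR_conv_of_real power2_eq_square field_simps)
    then have "h \<xi> * fourier g \<xi> = of_real (norm (fourier g \<xi>) powr (p - 1) * norm (fourier g \<xi>))"
      by (simp add: h_def mult_ac)
    also have "norm (fourier g \<xi>) powr (p - 1) * norm (fourier g \<xi>) = norm (fourier g \<xi>) powr p"
      using False powr_add[of "norm (fourier g \<xi>)" "p - 1" 1] by simp
    also have "\<dots> = norm (h \<xi>) powr q" by (simp add: norm_h powr_powr pq)
    finally show ?thesis .
  qed (simp add: h_def)
  show ?thesis
  proof (rule nn_integral_limit_le)
    fix n :: nat
    let ?h = "truncation (real (Suc n)) h"
    define B where "B = (\<integral>x. norm (?h x) powr q \<partial>lborel)"
    have h_int: "integrable lborel (\<lambda>x. norm (?h x) powr q)"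
    proof (rule integrable_of_bounded_support)
      show "norm (norm (?h x) powr q) \<le> real (Suc n) powr q" for x
        using q by (auto simp: truncation_def intro!: powr_mono2 simp del: of_nat_Suc)
      show "norm (?h x) powr q = 0" if "\<bar>x\<bar> > real (Suc n)" for x
        using that by (simp add: truncation_def)
    qed measurable
    have "B \<ge> 0" by (simp add: B_def)
    have "?h \<xi> * fourier g \<xi> = of_real (norm (?h \<xi>) powr q)" for \<xi>
      using hF[of \<xi>] by (simp add: truncation_def)
    then have "B = norm (CLBINT \<xi>. ?h \<xi> * fourier g \<xi>)"
      using \<open>B \<ge> 0\<close> by (simp add: B_def)
    also have "\<dots> \<le> (2 * pi) powr (1 - 1 / q) * (A * B) powr (1 / q)"
      unfolding A_def B_def using q by (intro fourier_pairing_le[OF g]) auto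
    finally have *: "B \<le> (2 * pi) powr (1 - 1 / q) * (A * B) powr (1 / q)" .
    have "B \<le> 2 * pi * A powr (p - 1)"
    proof (cases "B = 0")
      case False
      with \<open>B \<ge> 0\<close> have "B > 0" by simp
      have "B powr (1 / p) * B powr (1 / q) \<le> ((2 * pi) powr (1 - 1 / q) * A powr (1 / q)) * B powr (1 / q)"
        using * \<open>B > 0\<close> \<open>A \<ge> 0\<close> p by (simp add: powr_add[symmetric] powr_mult mult_ac)
      then have "B powr (1 / p) \<le> (2 * pi) powr (1 - 1 / q) * A powr (1 / q)"
        using \<open>B > 0\<close> by simp
      then have "(B powr (1 / p)) powr p \<le> ((2 * pi) powr (1 - 1 / q) * A powr (1 / q)) powr p"
        using \<open>p > 1\<close> by (intro powr_mono2) auto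
      then show ?thesis
        using \<open>B > 0\<close> \<open>p > 1\<close> \<open>A \<ge> 0\<close> pq by (simp add: powr_powr powr_mult)
    qed simp
    then show "(\<integral>\<^sup>+\<xi>. ennreal (norm (?h \<xi>) powr q) \<partial>lborel)
        \<le> ennreal (2 * pi * (\<integral>x. norm (g x) powr q \<partial>lborel) powr (p - 1))"
      using h_int by (subst nn_integral_eq_integral) (auto simp: A_def B_def ennreal_leI)
  next
    fix \<xi>
    have "(\<lambda>n. norm (truncation (real (Suc n)) h \<xi>) powr q) \<longlonglongrightarrow> norm (h \<xi>) powr q"
      using q by (intro tendsto_powr2 tendsto_norm truncation_tendsto tendsto_const) auto
    then show "(\<lambda>n. ennreal (norm (truncation (real (Suc n)) h \<xi>) powr q)) \<longlonglongrightarrow> ennreal (norm (fourier g \<xi>) powr p)"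
      by (intro tendsto_ennrealI) (simp add: norm_h powr_powr pq)
  qed measurable
qed

section \<open>The free Schroedinger evolution\<close>

lemma schrodinger_sol_eq_fourier:
  "schrodinger_sol u0 t x = 1 / (2 * of_real pi) *
    fourier (\<lambda>p. fourier u0 p * exp (\<i> * of_real (- t / 2 * p\<^sup>2))) (- x)"
proof -
  have "fourier u0 p * exp (- (1 / 2) * \<i> * of_real t * (of_real p)\<^sup>2 + \<i> * of_real x * of_real p)
    = fourier u0 p * exp (\<i> * of_real (- t / 2 * p\<^sup>2)) * exp (- \<i> * of_real p * of_real (- x))" for p
    unfolding mult.assoc mult_exp_exp by (simp add: mult_ac)
  then show ?thesis by (simp only: schrodinger_sol_def fourier_def[of "\<lambda>p. fourier u0 p * _ p"])
qed

lemma schwartz_schrodinger_datum: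
  assumes "schwartz u0"
  shows "schwartz (\<lambda>p. fourier u0 p * exp (\<i> * of_real (- t / 2 * p\<^sup>2)))"
  by (intro schwartz_times_chirp schwartz_fourier assms)

text \<open>
  Completing the square in \<open>- s p\<^sup>2 / 2 + x p\<close> turns the integral defining the solution at time \<open>t\<close> into
  the right-hand side of \<open>fourier_parseval_chirp\<close> with \<open>\<tau> = 1/s\<close> at the point \<open>x/s\<close>, up to the
  unimodular factor \<open>exp (- \<i> x\<^sup>2 / (2 s))\<close>.
\<close>

lemma schrodinger_sol_between_times:
  assumes u0: "schwartz u0" and "t \<noteq> t0"
  obtains g where "schwartz g"
    and "\<And>y. norm (g y) = norm (schrodinger_sol u0 t0 (- y))"
    and "\<And>x. norm (schrodinger_sol u0 t x)
      = (2 * pi * \<bar>t - t0\<bar>) powr (- 1 / 2) * norm (fourier g (- (x / (t - t0))))"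
proof
  define s where "s = t - t0"
  have "s \<noteq> 0" using \<open>t \<noteq> t0\<close> by (simp add: s_def)
  define w where "w = (\<lambda>p. fourier u0 p * exp (\<i> * of_real (- t0 / 2 * p\<^sup>2)))"
  have w: "schwartz w" unfolding w_def by (rule schwartz_schrodinger_datum[OF u0])
  define g where "g = (\<lambda>y. (1 / (2 * of_real pi) * fourier w y) * exp (\<i> * of_real (1 / (2 * s) * y\<^sup>2)))"
  show "schwartz g" unfolding g_def by (intro schwartz_times_chirp schwartz_cmult schwartz_fourier w)
  show "norm (g y) = norm (schrodinger_sol u0 t0 (- y))" for y
    unfolding g_def schrodinger_sol_eq_fourier w_def[symmetric]
    by (simp only: norm_mult norm_exp_i_times mult_1_right minus_minus)
  show "norm (schrodinger_sol u0 t x)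
      = (2 * pi * \<bar>t - t0\<bar>) powr (- 1 / 2) * norm (fourier g (- (x / (t - t0))))" for x
  proof -
    have "norm (CLBINT y. fourier w y * exp (\<i> * of_real (1 / s * y\<^sup>2 / 2 + x / s * y)))
      = sqrt (2 * pi / \<bar>1 / s\<bar>) * norm (CLBINT p. w p * exp (- \<i> * of_real ((x / s - p)\<^sup>2 / (2 * (1 / s)))))"
      using \<open>s \<noteq> 0\<close> by (intro fourier_parseval_chirp integrable_schwartz schwartz_fourier w) simp
    moreover have "(CLBINT y. fourier w y * exp (\<i> * of_real (1 / s * y\<^sup>2 / 2 + x / s * y)))
      = 2 * of_real pi * fourier g (- (x / s))"
    proof -
      have "fourier w y * exp (\<i> * of_real (1 / s * y\<^sup>2 / 2 + x / s * y))
        = 2 * of_real pi * (g y * exp (- \<i> * of_real y * of_real (- (x / s))))" for y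
      proof -
        have "exp (\<i> * of_real (1 / s * y\<^sup>2 / 2 + x / s * y))
          = exp (\<i> * of_real (1 / (2 * s) * y\<^sup>2)) * exp (- \<i> * of_real y * of_real (- (x / s)))"
          by (simp add: mult_exp_exp algebra_simps)
        then show ?thesis by (simp add: g_def)
      qed
      then show ?thesis by (simp only: fourier_def[of g] integral_mult_right_zero)
    qed
    moreover have "(CLBINT p. w p * exp (- \<i> * of_real ((x / s - p)\<^sup>2 / (2 * (1 / s)))))
      = exp (- \<i> * of_real (x\<^sup>2 / (2 * s))) * (2 * of_real pi * schrodinger_sol u0 t x)"
    proof -
      have "w p * exp (- \<i> * of_real ((x / s - p)\<^sup>2 / (2 * (1 / s))))
        = exp (- \<i> * of_real (x\<^sup>2 / (2 * s))) *
          (fourier u0 p * exp (- (1 / 2) * \<i> * of_real t * (of_real p)\<^sup>2 + \<i> * of_real x * of_real p))" for p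
      proof -
        have "- t0 / 2 * p\<^sup>2 - (x / s - p)\<^sup>2 / (2 * (1 / s)) = - (x\<^sup>2 / (2 * s)) - t / 2 * p\<^sup>2 + x * p"
        proof -
          have sq: "(x / s - p)\<^sup>2 / (2 * (1 / s)) = x\<^sup>2 / (2 * s) - x * p + s / 2 * p\<^sup>2"
            using \<open>s \<noteq> 0\<close> by (simp add: power2_eq_square field_simps)
          have t: "t = t0 + s" by (simp add: s_def)
          show ?thesis unfolding sq t by (simp add: algebra_simps add_divide_distrib)
        qed
        then have "\<i> * of_real (- t0 / 2 * p\<^sup>2 - (x / s - p)\<^sup>2 / (2 * (1 / s)))
          = \<i> * of_real (- (x\<^sup>2 / (2 * s)) - t / 2 * p\<^sup>2 + x * p)" by (simp only:)
        then have "\<i> * of_real (- t0 / 2 * p\<^sup>2) + - \<i> * of_real ((x / s - p)\<^sup>2 / (2 * (1 / s)))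
          = - \<i> * of_real (x\<^sup>2 / (2 * s)) + (- (1 / 2) * \<i> * of_real t * (of_real p)\<^sup>2 + \<i> * of_real x * of_real p)"
          by (simp add: algebra_simps)
        then have "exp (\<i> * of_real (- t0 / 2 * p\<^sup>2)) * exp (- \<i> * of_real ((x / s - p)\<^sup>2 / (2 * (1 / s))))
          = exp (- \<i> * of_real (x\<^sup>2 / (2 * s))) *
            exp (- (1 / 2) * \<i> * of_real t * (of_real p)\<^sup>2 + \<i> * of_real x * of_real p)"
          by (simp only: mult_exp_exp)
        then show ?thesis unfolding w_def by (simp only: mult_ac)
      qed
      then show ?thesis by (simp add: schrodinger_sol_def)
    qed
    ultimately have eq: "norm (fourier g (- (x / s))) = sqrt (2 * pi / \<bar>1 / s\<bar>) * norm (schrodinger_sol u0 t x)"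
      by (simp add: norm_mult)
    have pos: "2 * pi * \<bar>s\<bar> > 0" using \<open>s \<noteq> 0\<close> by simp
    have "(2 * pi * \<bar>s\<bar>) powr (- 1 / 2) * sqrt (2 * pi / \<bar>1 / s\<bar>) = 1"
    proof -
      have "2 * pi / \<bar>1 / s\<bar> = 2 * pi * \<bar>s\<bar>" by simp
      then show ?thesis using pos \<open>s \<noteq> 0\<close> by (simp add: powr_minus powr_half_sqrt)
    qed
    then show ?thesis unfolding s_def[symmetric] eq mult.assoc[symmetric] by simp
  qed
qed

lemma schrodinger_sol_measurable:
  assumes "schwartz u0"
  shows "schrodinger_sol u0 t \<in> borel_measurable borel"
proof -
  note [measurable] = fourier_measurable[OF integrable_schwartz[OF schwartz_schrodinger_datum[OF assms]], of t]
  show ?thesis unfolding schrodinger_sol_eq_fourier[abs_def] by measurable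
qed

lemma integrable_powr_schwartz:
  assumes f: "schwartz f" and "q \<ge> 1"
  shows "integrable lborel (\<lambda>x. norm (f x) powr q)"
proof -
  note [measurable] = schwartz_measurable[OF f]
  obtain B where B: "norm (f x) \<le> B" for x
    using schwartz_decay[OF f, of 0] by (auto simp: bounded_iff)
  have int: "integrable lborel (\<lambda>x. B powr (q - 1) * norm (f x))"
    using integrable_schwartz[OF f] by simp
  have "norm (f x) powr q \<le> B powr (q - 1) * norm (f x)" for x
  proof (cases "f x = 0")
    case False
    then have "norm (f x) powr q = norm (f x) powr (q - 1) * norm (f x)"
      using powr_add[of "norm (f x)" "q - 1" 1] by simp
    also have "\<dots> \<le> B powr (q - 1) * norm (f x)"
      using B \<open>q \<ge> 1\<close> by (intro mult_right_mono powr_mono2) auto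
    finally show ?thesis .
  qed (use \<open>q \<ge> 1\<close> in simp)
  then show ?thesis
    by (intro Bochner_Integration.integrable_bound[OF int]) auto
qed

lemma Lp_norm_ennreal_le:
  assumes "p > 0" "K \<ge> 0" and le: "(\<integral>\<^sup>+x. ennreal (norm (f x) powr p) \<partial>lborel) \<le> ennreal K"
  shows "Lp_norm (ennreal p) f \<le> ennreal (K powr (1 / p))"
proof -
  let ?I = "\<integral>\<^sup>+x. ennreal (norm (f x) powr p) \<partial>lborel"
  have "?I < \<infinity>" using le by (auto simp: top.not_eq_extremum intro: le_less_trans)
  moreover have "enn2real ?I \<le> K"
    using enn2real_mono[OF le] \<open>K \<ge> 0\<close> by simp
  ultimately show ?thesis
    using assms by (auto simp: Lp_norm_def ennreal_powr_def intro!: ennreal_leI powr_mono2)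
qed

lemma Lp_norm_ennreal_eq:
  assumes "q > 0" "integrable lborel (\<lambda>x. norm (f x) powr q)"
  shows "Lp_norm (ennreal q) f = ennreal ((\<integral>x. norm (f x) powr q \<partial>lborel) powr (1 / q))"
  using assms by (simp add: Lp_norm_def ennreal_powr_def nn_integral_eq_integral)

text \<open>
  The Hausdorff--Young inequality for \<open>g\<close>. With \<open>\<kappa> = 2 \<pi> |s|\<close>, the prefactor contributes \<open>\<kappa>\<^bsup>-r/2\<^esup>\<close> to
  the integral of the \<open>r\<close>-th power, and the substitution \<open>\<xi> = -x/s\<close> together with the constant of the
  inequality contributes one factor \<open>\<kappa>\<close>.
\<close>

lemma dispersive_estimate:
  assumes u0: "schwartz u0" and "t \<noteq> t0" and r: "r \<ge> 2" "1 / r + 1 / q = 1"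
  shows "Lp_norm (ennreal r) (schrodinger_sol u0 t)
    \<le> ennreal ((2 * pi * \<bar>t - t0\<bar>) powr (- 1 / 2 + 1 / r)) * Lp_norm (ennreal q) (schrodinger_sol u0 t0)"
proof -
  define s where "s = t - t0"
  have "s \<noteq> 0" using \<open>t \<noteq> t0\<close> by (simp add: s_def)
  define \<kappa> where "\<kappa> = 2 * pi * \<bar>s\<bar>"
  have "\<kappa> > 0" using \<open>s \<noteq> 0\<close> by (simp add: \<kappa>_def)
  have q_inv: "1 / q = 1 - 1 / r" using r by simp
  moreover have "1 / r > 0" "1 / r \<le> 1 / 2" using r(1) by (auto simp: field_simps)
  ultimately have "1 / q > 0" "1 / q < 1" "1 / q \<ge> 1 / 2" by linarith+
  then have "q > 0" by simp
  with \<open>1 / q < 1\<close> \<open>1 / q \<ge> 1 / 2\<close> have q: "1 < q" "q \<le> 2" by (auto simp: field_simps)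
  obtain g where g: "schwartz g"
    and norm_g: "\<And>y. norm (g y) = norm (schrodinger_sol u0 t0 (- y))"
    and norm_u: "\<And>x. norm (schrodinger_sol u0 t x) = \<kappa> powr (- 1 / 2) * norm (fourier g (- (x / s)))"
    using schrodinger_sol_between_times[OF u0 \<open>t \<noteq> t0\<close>] unfolding \<kappa>_def s_def by metis
  note [measurable] = fourier_measurable[OF integrable_schwartz[OF g]] schrodinger_sol_measurable[OF u0]
  define I where "I = (\<integral>x. norm (g x) powr q \<partial>lborel)"
  have g_int: "integrable lborel (\<lambda>x. norm (g x) powr q)"
    using g q by (intro integrable_powr_schwartz) auto
  have I: "I = (\<integral>x. norm (schrodinger_sol u0 t0 x) powr q \<partial>lborel)"
    unfolding I_def norm_g
    using lborel_integral_real_affine[of "- 1" "\<lambda>x. norm (schrodinger_sol u0 t0 x) powr q" 0] by simp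
  have u_int: "integrable lborel (\<lambda>x. norm (schrodinger_sol u0 t0 x) powr q)"
    using lborel_integrable_real_affine[OF g_int, of "- 1" 0] by (simp add: norm_g)
  have "I \<ge> 0" by (simp add: I_def)
  define K where "K = \<kappa> powr (- r / 2) * (\<kappa> * I powr (r - 1))"
  have "(\<integral>\<^sup>+x. ennreal (norm (schrodinger_sol u0 t x) powr r) \<partial>lborel)
    = (\<integral>\<^sup>+x. ennreal (\<kappa> powr (- r / 2)) * ennreal (norm (fourier g (- (x / s))) powr r) \<partial>lborel)"
    using r \<open>\<kappa> > 0\<close> by (simp add: norm_u powr_mult powr_powr ennreal_mult)
  also have "\<dots> = ennreal (\<kappa> powr (- r / 2)) * (\<integral>\<^sup>+x. ennreal (norm (fourier g (- (x / s))) powr r) \<partial>lborel)"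
    by (rule nn_integral_cmult) measurable
  also have "(\<integral>\<^sup>+x. ennreal (norm (fourier g (- (x / s))) powr r) \<partial>lborel)
    = ennreal \<bar>s\<bar> * (\<integral>\<^sup>+\<xi>. ennreal (norm (fourier g \<xi>) powr r) \<partial>lborel)"
    using \<open>s \<noteq> 0\<close>
    by (subst nn_integral_real_affine[where c = "- s" and t = 0]) auto
  also have "\<dots> \<le> ennreal \<bar>s\<bar> * ennreal (2 * pi * I powr (r - 1))"
    unfolding I_def using r q
    by (intro mult_left_mono hausdorff_young integrable_schwartz g g_int) auto
  finally have "(\<integral>\<^sup>+x. ennreal (norm (schrodinger_sol u0 t x) powr r) \<partial>lborel)
    \<le> ennreal (\<kappa> powr (- r / 2)) * (ennreal \<bar>s\<bar> * ennreal (2 * pi * I powr (r - 1)))"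
    by (simp add: mult_left_mono)
  also have "\<dots> = ennreal K"
    by (simp add: K_def \<kappa>_def mult_ac flip: ennreal_mult)
  finally have "Lp_norm (ennreal r) (schrodinger_sol u0 t) \<le> ennreal (K powr (1 / r))"
    using r \<open>\<kappa> > 0\<close> by (intro Lp_norm_ennreal_le) (auto simp: K_def)
  also have "K powr (1 / r) = \<kappa> powr (- 1 / 2 + 1 / r) * I powr (1 / q)"
  proof -
    have "K = \<kappa> powr (1 - r / 2) * I powr (r - 1)"
      using \<open>\<kappa> > 0\<close> powr_add[of \<kappa> "- r / 2" 1] by (simp add: K_def)
    then have "K powr (1 / r) = \<kappa> powr ((1 - r / 2) / r) * I powr ((r - 1) / r)"
      using \<open>\<kappa> > 0\<close> by (simp add: powr_mult powr_powr)
    also have "(1 - r / 2) / r = - 1 / 2 + 1 / r" using r by (simp add: field_simps)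
    also have "(r - 1) / r = 1 / q" using r q_inv by (simp add: field_simps)
    finally show ?thesis .
  qed
  also have "ennreal (\<kappa> powr (- 1 / 2 + 1 / r) * I powr (1 / q))
    = ennreal (\<kappa> powr (- 1 / 2 + 1 / r)) * Lp_norm (ennreal q) (schrodinger_sol u0 t0)"
    using \<open>q > 0\<close> u_int by (subst Lp_norm_ennreal_eq) (auto simp: I ennreal_mult)
  finally show ?thesis by (simp only: \<kappa>_def s_def)
qed

lemma dispersive_estimate_sup:
  assumes u0: "schwartz u0" and "t \<noteq> t0"
  shows "Lp_norm \<infinity> (schrodinger_sol u0 t)
    \<le> ennreal ((2 * pi * \<bar>t - t0\<bar>) powr (- 1 / 2)) * Lp_norm 1 (schrodinger_sol u0 t0)"
proof -
  obtain g where g: "schwartz g"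
    and norm_g: "\<And>y. norm (g y) = norm (schrodinger_sol u0 t0 (- y))"
    and norm_u: "\<And>x. norm (schrodinger_sol u0 t x)
      = (2 * pi * \<bar>t - t0\<bar>) powr (- 1 / 2) * norm (fourier g (- (x / (t - t0))))"
    using schrodinger_sol_between_times[OF u0 \<open>t \<noteq> t0\<close>] by metis
  note [measurable] = schrodinger_sol_measurable[OF u0]
  define I where "I = (\<integral>x. norm (g x) \<partial>lborel)"
  have I: "I = (\<integral>x. norm (schrodinger_sol u0 t0 x) powr 1 \<partial>lborel)"
    unfolding I_def norm_g
    using lborel_integral_real_affine[of "- 1" "\<lambda>x. norm (schrodinger_sol u0 t0 x)" 0] by simp
  have u_int: "integrable lborel (\<lambda>x. norm (schrodinger_sol u0 t0 x) powr 1)"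
    using lborel_integrable_real_affine[OF integrable_norm[OF integrable_schwartz[OF g]], of "- 1" 0]
    by (simp add: norm_g)
  have "I \<ge> 0" by (simp add: I_def)
  have "norm (schrodinger_sol u0 t x) \<le> (2 * pi * \<bar>t - t0\<bar>) powr (- 1 / 2) * I" for x
    unfolding norm_u I_def
    by (intro mult_left_mono norm_fourier_le integrable_schwartz g) simp
  then have "esssup lborel (\<lambda>x. ennreal (norm (schrodinger_sol u0 t x)))
    \<le> ennreal ((2 * pi * \<bar>t - t0\<bar>) powr (- 1 / 2) * I)"
    by (intro esssup_I AE_I2 ennreal_leI) auto
  also have "\<dots> = ennreal ((2 * pi * \<bar>t - t0\<bar>) powr (- 1 / 2)) * Lp_norm (ennreal 1) (schrodinger_sol u0 t0)"
    using u_int \<open>I \<ge> 0\<close> by (subst Lp_norm_ennreal_eq) (auto simp: I ennreal_mult)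
  finally show ?thesis by (simp add: Lp_norm_def)
qed

text \<open>
  A power with nonpositive exponent decreases in its base, so \<open>2 \<pi>\<close> may be replaced by the smaller
  number \<open>1 / (4 \<pi>)\<close>.
\<close>

lemma dispersive_constant_le:
  fixes s a :: real
  assumes "a \<le> 0"
  shows "ennreal ((2 * pi * \<bar>s\<bar>) powr a) * L \<le> ennreal ((1 / (4 * pi)) powr a) * L * ennreal (\<bar>s\<bar> powr a)"
proof -
  have "1 / (4 * pi) \<le> 2 * pi"
  proof -
    have "1 / (4 * pi) \<le> 1" using pi_gt3 by simp
    then show ?thesis using pi_gt3 by linarith
  qed
  then have "(2 * pi) powr a \<le> (1 / (4 * pi)) powr a"
    using assms by (intro powr_mono2') auto
  then have "(2 * pi * \<bar>s\<bar>) powr a \<le> (1 / (4 * pi)) powr a * \<bar>s\<bar> powr a"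
    by (subst powr_mult) (auto intro: mult_right_mono)
  then have "ennreal ((2 * pi * \<bar>s\<bar>) powr a) * L \<le> ennreal ((1 / (4 * pi)) powr a * \<bar>s\<bar> powr a) * L"
    by (intro mult_right_mono ennreal_leI) auto
  also have "\<dots> = ennreal ((1 / (4 * pi)) powr a) * L * ennreal (\<bar>s\<bar> powr a)"
    by (subst ennreal_mult) (auto simp: mult_ac)
  finally show ?thesis .
qed

theorem proposition1p2:
  fixes u0 :: "real \<Rightarrow> complex" and tstar t :: real and p p' :: ennreal
  assumes "schwartz u0"
    and "is_arg_min (\<lambda>\<tau>. position_variance (schrodinger_sol u0 \<tau>)) (\<lambda>_. True) tstar"
    and "2 \<le> p"
    and "1 / p + 1 / p' = 1"
    and "t \<noteq> tstar"
  shows "Lp_norm p (schrodinger_sol u0 t)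
    \<le> ennreal ((1 / (4 * pi)) powr (- 1 / 2 + enn2real (1 / p)))
      * Lp_norm p' (schrodinger_sol u0 tstar)
      * ennreal (\<bar>t - tstar\<bar> powr (- 1 / 2 + enn2real (1 / p)))"
proof (cases p)
  case top
  then have "1 / p' = 1" using assms(4) by simp
  then have "p' = 1"
  proof (cases p')
    case (real q)
    have "q \<noteq> 0" using \<open>1 / p' = 1\<close> real by auto
    with real have "ennreal (1 / q) = ennreal 1"
      using \<open>1 / p' = 1\<close> divide_ennreal[of 1 q] by simp
    then show ?thesis using \<open>q \<noteq> 0\<close> real by (subst (asm) ennreal_inj) auto
  qed simp
  have "Lp_norm p (schrodinger_sol u0 t)
    \<le> ennreal ((2 * pi * \<bar>t - tstar\<bar>) powr (- 1 / 2)) * Lp_norm p' (schrodinger_sol u0 tstar)"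
    using dispersive_estimate_sup[OF assms(1,5)] by (simp add: top \<open>p' = 1\<close>)
  also have "\<dots> \<le> ennreal ((1 / (4 * pi)) powr (- 1 / 2)) * Lp_norm p' (schrodinger_sol u0 tstar)
      * ennreal (\<bar>t - tstar\<bar> powr (- 1 / 2))"
    by (rule dispersive_constant_le) simp
  finally show ?thesis by (simp add: top)
next
  case (real r)
  have "r \<ge> 2"
  proof -
    have "ennreal 2 \<le> ennreal r" using assms(3) real by simp
    then show ?thesis using real by (simp only: ennreal_le_iff)
  qed
  have inv_p: "1 / p = ennreal (1 / r)"
    using \<open>r \<ge> 2\<close> real divide_ennreal[of 1 r] by simp
  obtain q where q: "p' = ennreal q" "q > 0" "1 / r + 1 / q = 1"
  proof (cases p')
    case top
    then have "ennreal (1 / r) = ennreal 1" using assms(4) inv_p by simp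
    then have False using \<open>r \<ge> 2\<close> by (subst (asm) ennreal_inj) auto
    then show ?thesis ..
  next
    case (real q)
    have "q \<noteq> 0" using assms(4) real by auto
    with real have "q > 0" by simp
    then have "1 / p' = ennreal (1 / q)" using real divide_ennreal[of 1 q] by simp
    then have "ennreal (1 / r + 1 / q) = ennreal 1"
      using assms(4) inv_p \<open>r \<ge> 2\<close> \<open>q > 0\<close> by simp
    then have "1 / r + 1 / q = 1"
      using \<open>r \<ge> 2\<close> \<open>q > 0\<close> by (subst (asm) ennreal_inj) auto
    then show ?thesis using that real \<open>q > 0\<close> by blast
  qed
  have "Lp_norm p (schrodinger_sol u0 t)
    \<le> ennreal ((2 * pi * \<bar>t - tstar\<bar>) powr (- 1 / 2 + 1 / r)) * Lp_norm p' (schrodinger_sol u0 tstar)"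
    using dispersive_estimate[OF assms(1,5) \<open>r \<ge> 2\<close> q(3)] by (simp add: real q)
  also have "\<dots> \<le> ennreal ((1 / (4 * pi)) powr (- 1 / 2 + 1 / r)) * Lp_norm p' (schrodinger_sol u0 tstar)
      * ennreal (\<bar>t - tstar\<bar> powr (- 1 / 2 + 1 / r))"
    using \<open>r \<ge> 2\<close> by (intro dispersive_constant_le) (simp add: field_simps)
  finally show ?thesis using \<open>r \<ge> 2\<close> by (simp add: inv_p)
qed

end
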